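(* In the Bayesian spanning forest (BSF) model with symmetric leaf kernel and oracle partition described in the context, let $y^{(n)}=(y_1,\dots,y_n)\sim P_0^{(n)}$ for each $n$. Assume: (A1) there exist constants $C_1,C_2>0$ (not depending on $n$ or on the data) such that for all sufficiently large $n$, $C_1\delta_n\le \min_{i\in[n]} r_n(y_i)\le\max_{i\in[n]} r_n(y_i)\le C_2\delta_n$; (A2) $K_{0,n}=o(\sqrt n)$ as $n\to\infty$. For $\phi=(c_1,c_2,\iota_1,\iota_2)$ with positive entries put $$\mathcal D^{(n)}_\phi=\Big\{y^{(n)}:\ \frac{\max_{s\not\sim t;\,s,t\in[n]}f^{(n)}_{st}}{\delta_n\lambda_n}\le c_1(K_{0,n}-1+\iota_1)^{-n},\quad \frac{\delta_n\lambda_n}{\min_{s'\sim t';\,s',t'\in[n]}f^{(n)}_{s't'}}\le c_2(K_{0,n}+1+\iota_2)^{-n}\Big\}.$$ If there is a fixed $\phi$ (not depending on $n$) such that $P_0^{(n)}(y^{(n)}\notin\mathcal D^{(n)}_\phi)\to0$ as $n\to\infty$, then $$\mathbb E_{P_0^{(n)}}\big[\Pi(\mathcal V_n\not\sim(V_1^{0,n},\dots,V_{K_{0,n}}^{0,n})\mid y^{(n)})\big]\to0\quad\text{as } n\to\infty .$$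
   Context: Oracle. $(V_1^0,V_2^0,\dots)$ is a fixed partition of the positive integers into disjoint sets. For each $n$, $[n]=\{1,\dots,n\}$, $V_k^{0,n}=V_k^0\cap[n]$, and $K_{0,n}$ is the number of nonempty sets among these, labelled $k=1,\dots,K_{0,n}$. For distinct $s,t\in[n]$, $s\sim t$ means that $s,t$ lie in the same oracle cluster, $s\not\sim t$ that they do not. All minima/maxima over pairs are over pairs of distinct indices; when $K_{0,n}=1$ the condition on pairs $s\not\sim t$ is vacuous. Data. For each $n$ the data are $y^{(n)}=(y_1,\dots,y_n)$ with values in a metric space $\mathcal Y$ (a triangular array: data for different $n$ need not be nested), and $P_0^{(n)}$ is the law of $y^{(n)}$ for the given oracle partition; no independence is required. BSF model. For each $n$ there are: a symmetric nonnegative leaf kernel giving weights $f^{(n)}_{st}=f(y_t\mid y_s;\theta_n)=f^{(n)}_{ts}\ge0$ for $s\ne t$; a positive root kernel $r_n$ on $\mathcal Y$; and numbers $\delta_n>0$, $\lambda_n>0$. For nonempty $V\subset[n]$, $L_V$ is the graph Laplacian on $V$ with edge weights $f^{(n)}_{st}$ (off-diagonal entries $-f^{(n)}_{st}$, diagonal entries $\sum_{t\in V,t\neq s}f^{(n)}_{st}$), and $|L_V[1]|$ is the determinant of $L_V$ with first row and column removed (equal to $1$ if $|V|=1$). The integrated posterior on ordered partitions $(V_1,\dots,V_K)$ of $[n]$ into $K$ nonempty sets, $K\in\{1,\dots,n\}$, is $$\Pi^*(\mathcal V_n=(V_1,\dots,V_K)\mid y^{(n)})=C_n\prod_{k=1}^K\Big[\lambda_n\Big(\sum_{i\in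 V_k}r_n(y_i)\Big)|L_{V_k}[1]|\Big],$$ with $C_n$ the normalizing constant. Two ordered partitions are equivalent ($\sim$) if they agree up to relabelling of blocks; $\Pi(\mathcal V_n\sim(V_1,\dots,V_K)\mid y^{(n)})=K!\,\Pi^*(\mathcal V_n=(V_1,\dots,V_K)\mid y^{(n)})$, and $\Pi(\mathcal V_n\not\sim\cdot\mid y^{(n)})=1-\Pi(\mathcal V_n\sim\cdot\mid y^{(n)})$. *)

theory Defs
  imports
    "HOL-Probability.Probability"
    "HOL-Library.Landau_Symbols"
    "HOL-Combinatorics.Multiset_Permutations"
    "Jordan_Normal_Form.Determinant"
begin

section \<open>Oracle partition\<close>

text \<open>
  The oracle is a sequence \<open>V0 1, V0 2, \<dots>\<close>; the value \<open>V0 0\<close> is not used. Members of the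
  sequence may be empty, so that partitions of the positive integers into finitely many
  clusters are included.
\<close>

definition oracle_partition :: "(nat \<Rightarrow> nat set) \<Rightarrow> bool" where
  "oracle_partition V0 \<longleftrightarrow> disjoint_family_on V0 {1..} \<and> (\<Union>k\<in>{1..}. V0 k) = {1..}"

definition oracle_labels :: "(nat \<Rightarrow> nat set) \<Rightarrow> nat \<Rightarrow> nat set" where
  "oracle_labels V0 n = {k \<in> {1..}. V0 k \<inter> {1..n} \<noteq> {}}"

definition oracle_K :: "(nat \<Rightarrow> nat set) \<Rightarrow> nat \<Rightarrow> nat" where
  "oracle_K V0 n = card (oracle_labels V0 n)"

definition oracle_blocks :: "(nat \<Rightarrow> nat set) \<Rightarrow> nat \<Rightarrow> nat set list" where
  "oracle_blocks V0 n = map (\<lambda>k. V0 k \<inter> {1..n}) (sorted_list_of_set (oracle_labels V0 n))"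

definition same_cluster :: "(nat \<Rightarrow> nat set) \<Rightarrow> nat \<Rightarrow> nat \<Rightarrow> bool" where
  "same_cluster V0 s t \<longleftrightarrow> (\<exists>k\<ge>1. s \<in> V0 k \<and> t \<in> V0 k)"

definition within_pairs :: "(nat \<Rightarrow> nat set) \<Rightarrow> nat \<Rightarrow> (nat \<times> nat) set" where
  "within_pairs V0 n = {(s, t). s \<in> {1..n} \<and> t \<in> {1..n} \<and> s \<noteq> t \<and> same_cluster V0 s t}"

definition between_pairs :: "(nat \<Rightarrow> nat set) \<Rightarrow> nat \<Rightarrow> (nat \<times> nat) set" where
  "between_pairs V0 n = {(s, t). s \<in> {1..n} \<and> t \<in> {1..n} \<and> s \<noteq> t \<and> \<not> same_cluster V0 s t}"

section \<open>The Bayesian spanning forest posterior\<close>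

text \<open>
  A leaf kernel is a function \<open>f\<close> with \<open>f v u\<close> standing for $f(v \mid u; \theta)$. The data
  \<open>y\<close> are indexed by \<open>{1..n}\<close>.
\<close>

definition edge_weight :: "('a \<Rightarrow> 'a \<Rightarrow> real) \<Rightarrow> (nat \<Rightarrow> 'a) \<Rightarrow> nat \<Rightarrow> nat \<Rightarrow> real" where
  "edge_weight f y s t = f (y t) (y s)"

text \<open>Rows and columns are indexed by the elements of \<open>V\<close> in increasing order.\<close>

definition laplacian :: "(nat \<Rightarrow> nat \<Rightarrow> real) \<Rightarrow> nat set \<Rightarrow> real mat" where
  "laplacian w V = (let vs = sorted_list_of_set V in
     mat (card V) (card V) (\<lambda>(i, j).
       if i = j then \<Sum>t \<in> V - {vs ! i}. w (vs ! i) t else - w (vs ! i) (vs ! j)))"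

text \<open>For a singleton \<open>V\<close> the reduced matrix is the empty one, whose determinant is 1.\<close>

definition laplacian_minor :: "(nat \<Rightarrow> nat \<Rightarrow> real) \<Rightarrow> nat set \<Rightarrow> real" where
  "laplacian_minor w V = Determinant.det (mat_delete (laplacian w V) 0 0)"

definition ordered_partitions :: "nat \<Rightarrow> nat set list set" where
  "ordered_partitions n = {Vs. distinct Vs \<and> partition_on {1..n} (set Vs)}"

definition bsf_weight ::
  "real \<Rightarrow> ('a \<Rightarrow> real) \<Rightarrow> ('a \<Rightarrow> 'a \<Rightarrow> real) \<Rightarrow> (nat \<Rightarrow> 'a) \<Rightarrow> nat set list \<Rightarrow> real" where
  "bsf_weight lam r f y Vs =
     (\<Prod>V\<leftarrow>Vs. lam * (\<Sum>i\<in>V. r (y i)) * laplacian_minor (edge_weight f y) V)"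

definition bsf_const ::
  "nat \<Rightarrow> real \<Rightarrow> ('a \<Rightarrow> real) \<Rightarrow> ('a \<Rightarrow> 'a \<Rightarrow> real) \<Rightarrow> (nat \<Rightarrow> 'a) \<Rightarrow> real" where
  "bsf_const n lam r f y = 1 / (\<Sum>Vs\<in>ordered_partitions n. bsf_weight lam r f y Vs)"

definition post_ordered ::
  "nat \<Rightarrow> real \<Rightarrow> ('a \<Rightarrow> real) \<Rightarrow> ('a \<Rightarrow> 'a \<Rightarrow> real) \<Rightarrow> (nat \<Rightarrow> 'a) \<Rightarrow> nat set list \<Rightarrow> real" where
  "post_ordered n lam r f y Vs = bsf_const n lam r f y * bsf_weight lam r f y Vs"

definition post_equiv ::
  "nat \<Rightarrow> real \<Rightarrow> ('a \<Rightarrow> real) \<Rightarrow> ('a \<Rightarrow> 'a \<Rightarrow> real) \<Rightarrow> (nat \<Rightarrow> 'a) \<Rightarrow> nat set list \<Rightarrow> real" where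
  "post_equiv n lam r f y Vs = fact (length Vs) * post_ordered n lam r f y Vs"

definition post_not_equiv ::
  "nat \<Rightarrow> real \<Rightarrow> ('a \<Rightarrow> real) \<Rightarrow> ('a \<Rightarrow> 'a \<Rightarrow> real) \<Rightarrow> (nat \<Rightarrow> 'a) \<Rightarrow> nat set list \<Rightarrow> real" where
  "post_not_equiv n lam r f y Vs = 1 - post_equiv n lam r f y Vs"

text \<open>
  The factor $K!$ makes \<open>post_equiv\<close> the posterior mass of the equivalence class under
  relabelling: equivalent ordered partitions are those with the same set of blocks.
\<close>

lemma post_equiv_eq_class_mass:
  assumes "Vs \<in> ordered_partitions n"
  shows "post_equiv n lam r f y Vs =
    (\<Sum>Ws \<in> {Ws \<in> ordered_partitions n. set Ws = set Vs}. post_ordered n lam r f y Ws)"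
proof -
  have d: "distinct Vs" using assms by (simp add: ordered_partitions_def)
  have eq: "{Ws \<in> ordered_partitions n. set Ws = set Vs} = permutations_of_set (set Vs)"
    using assms by (auto simp: ordered_partitions_def permutations_of_set_def)
  have "post_ordered n lam r f y Ws = post_ordered n lam r f y Vs"
    if "Ws \<in> permutations_of_set (set Vs)" for Ws
  proof -
    have "distinct Ws" "set Ws = set Vs"
      using that by (auto simp: permutations_of_set_def)
    with d show ?thesis
      by (simp add: post_ordered_def bsf_weight_def prod.distinct_set_conv_list [symmetric])
  qed
  then show ?thesis
    unfolding eq by (simp add: post_equiv_def distinct_card [OF d])
qed

section \<open>The separation event\<close>

text \<open>
  The maximum and minimum are taken in the extended reals. Hence a condition over an empty set of
  pairs holds vacuously (a supremum over the empty set is \<open>-\<infinity>\<close>, and division by an infimum over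
  the empty set, which is \<open>\<infinity>\<close>, gives 0), and the second condition fails if some within-cluster
  weight is 0, since then the ratio is \<open>\<infinity>\<close> rather than 0 as it would be over the reals.
\<close>

definition separation_event ::
  "(nat \<Rightarrow> nat set) \<Rightarrow> nat \<Rightarrow> real \<Rightarrow> real \<Rightarrow> ('a \<Rightarrow> 'a \<Rightarrow> real)
    \<Rightarrow> real \<Rightarrow> real \<Rightarrow> real \<Rightarrow> real \<Rightarrow> (nat \<Rightarrow> 'a) set" where
  "separation_event V0 n del lam f c1 c2 i1 i2 = {y \<in> {1..n} \<rightarrow>\<^sub>E UNIV.
     (SUP (s, t)\<in>between_pairs V0 n. ereal (edge_weight f y s t)) / ereal (del * lam)
       \<le> ereal (c1 * (real (oracle_K V0 n) - 1 + i1) powi (- int n)) \<and>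
     ereal (del * lam) / (INF (s, t)\<in>within_pairs V0 n. ereal (edge_weight f y s t))
       \<le> ereal (c2 * (real (oracle_K V0 n) + 1 + i2) powi (- int n))}"

end

theory Submission
  imports Defs "HOL-Real_Asymp.Real_Asymp"
begin

text \<open>
  By the matrix-tree theorem the unnormalised posterior is a sum over rooted forests, the roots being
  the minima of the blocks. Divide all edge weights by \<open>\<delta>\<^sub>n\<lambda>\<^sub>n\<close>. Cutting
  those edges of a forest that leave an oracle block (at most $n^j$ ways to restore $j$ such edges,
  each of weight at most $a = c_1(1+\iota_1)^{-n}$) gives a forest inside the oracle blocks, which
  becomes a family of oracle spanning trees after adding $e$ within-block edges, each gaining a factor
  at least $1/b = 2^n/c_2$. A forest not coming from the oracle partition has $(e,j) \ne (0,0)$, so the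
  competing partitions carry at most $O(1)\,(Cn^2)^{K_0}(n^3 b + n^2 a)$ times the oracle weight. As
  $K_0 = o(\sqrt n)$, the factor $(Cn^2)^{K_0}$ is subexponential and the bound tends to 0.
\<close>

text \<open>Competing partitions are superexponentially many while the separation rates are only
  geometric, so a uniform bound per competitor times their number diverges. Therefore the sum over
  partitions is kept inside a sum over forests: roots and parent function determine the partition,
  so cutting is injective once roots, cut vertices and lost targets are remembered, and all cut
  forests with the same roots are bounded together by the oracle weight. What remains is a sum over
  two vertex sets, the roots S and the cut vertices B. It stays bounded because a factor
  n^(-|S|-|B|) is set aside: the sum of n^(-|S|) over all S is (1 + 1/n)^n, at most exp 1, and
  likewise for B. This costs one n per root and one per cut vertex. Hence n^2 a (choice of target,
  factor set aside) and C n^2 per root (root sum, factor set aside); in n^3 b the additional n pays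
  for the growth of the factorial with the number of blocks. The rates (1 + iota_1)^(-n) and 2^(-n)
  arise from K_0 >= 2, valid as soon as a between-cluster pair exists, and from K_0 >= 1.\<close>

section \<open>The matrix-tree theorem\<close>

text \<open>A rooted spanning forest of \<open>V\<close> is encoded by its parent function on the vertices outside the
  root set \<open>S\<close>; the potential \<open>d\<close> excludes cycles.\<close>

definition forests :: "'a set \<Rightarrow> 'a set \<Rightarrow> ('a \<Rightarrow> 'a) set" where
  "forests V S = {g \<in> (V - S) \<rightarrow>\<^sub>E V. \<exists>d :: 'a \<Rightarrow> nat. \<forall>i\<in>V - S. d (g i) < d i}"

lemma forestsI:
  assumes "g \<in> (V - S) \<rightarrow>\<^sub>E V" and "\<And>i. i \<in> V \<Longrightarrow> i \<notin> S \<Longrightarrow> (d :: 'a \<Rightarrow> nat) (g i) < d i"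
  shows "g \<in> forests V S"
  using assms unfolding forests_def by blast

lemma forestsE:
  assumes "g \<in> forests V S"
  obtains d :: "'a \<Rightarrow> nat" where "\<And>i. i \<in> V \<Longrightarrow> i \<notin> S \<Longrightarrow> d (g i) < d i"
  using assms unfolding forests_def by blast

text \<open>Row \<open>i\<close> is the difference of the unit vectors at \<open>i\<close> and
  \<open>g i\<close>, the contribution of one edge to a Laplacian row. The unit row at
  \<open>r\<close> makes the determinant equal to the minor that deletes row and column
  \<open>r\<close>.\<close>

definition graph_mat :: "nat \<Rightarrow> nat \<Rightarrow> (nat \<Rightarrow> nat) \<Rightarrow> real mat" where
  "graph_mat m r g = mat m m (\<lambda>(i, j).
     if i = r then of_bool (j = r) else of_bool (j = i) - of_bool (j = g i))"

lemma finite_forests [simp]: "finite V \<Longrightarrow> finite (forests V S)"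
  unfolding forests_def by (rule finite_subset[of _ "(V - S) \<rightarrow>\<^sub>E V"]) (auto intro: finite_PiE)

lemma graph_mat_carrier [simp]: "graph_mat m r g \<in> carrier_mat m m"
  by (simp add: graph_mat_def)

text \<open>Only the identity survives in the Leibniz expansion: a permutation with nonzero product
  sends every moved vertex to its parent, so a moved vertex of least potential would go to a moved
  vertex of smaller potential. The diagonal entries are 1 because an acyclic \<open>g\<close> has no
  loops.\<close>

lemma det_graph_mat_acyclic:
  assumes r: "r < m" and g: "g \<in> forests {0..<m} {r}"
  shows "Determinant.det (graph_mat m r g) = 1"
proof -
  obtain d :: "nat \<Rightarrow> nat" where d: "\<And>i. i < m \<Longrightarrow> i \<noteq> r \<Longrightarrow> d (g i) < d i"
    using forestsE[OF g] by auto
  have gm: "g i < m" if "i < m" "i \<noteq> r" for i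
    using g that by (auto simp: forests_def PiE_iff)
  have zero: "(\<Prod>i = 0..<m. graph_mat m r g $$ (i, p i)) = 0"
    if p: "p permutes {0..<m}" and ne: "p \<noteq> id" for p
  proof (rule ccontr)
    assume nz: "(\<Prod>i = 0..<m. graph_mat m r g $$ (i, p i)) \<noteq> 0"
    have pm: "p i < m" if "i < m" for i
      using permutes_in_image[OF p, of i] that by simp
    have entry: "graph_mat m r g $$ (i, p i) \<noteq> 0" if "i < m" for i
      using nz that by (auto simp: prod_zero_iff)
    have step: "i \<noteq> r \<and> p i = g i" if "i < m" "p i \<noteq> i" for i
      using entry[OF that(1)] pm[OF that(1)] that
      by (auto simp: graph_mat_def split: if_splits)
    obtain x where "p x \<noteq> x" using ne by (auto simp: fun_eq_iff)
    then have "\<exists>x. x < m \<and> p x \<noteq> x"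
      using p by (auto simp: permutes_def)
    then obtain x where x: "x < m" "p x \<noteq> x"
      and mn: "\<And>y. y < m \<Longrightarrow> p y \<noteq> y \<Longrightarrow> d x \<le> d y"
      using ex_has_least_nat[of "\<lambda>x. x < m \<and> p x \<noteq> x" _ d] by blast
    have "p (p x) \<noteq> p x" using permutes_inj[OF p] x(2) by (auto dest: injD)
    then have "d x \<le> d (p x)" using mn pm[OF x(1)] by blast
    then show False using step[OF x] d[OF x(1)] by auto
  qed
  have diag: "graph_mat m r g $$ (i, i) = 1" if "i < m" for i
  proof (cases "i = r")
    case False
    then have "g i \<noteq> i" using d[OF that] by auto
    then show ?thesis using that False by (simp add: graph_mat_def)
  qed (use that in \<open>simp add: graph_mat_def\<close>)
  have "Determinant.det (graph_mat m r g) =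
      (\<Sum>p | p permutes {0..<m}. signof p * (\<Prod>i = 0..<m. graph_mat m r g $$ (i, p i)))"
    by (simp add: det_def')
  also have "\<dots> = (\<Sum>p\<in>{id}. signof p * (\<Prod>i = 0..<m. graph_mat m r g $$ (i, p i)))"
    by (rule sum.mono_neutral_right) (auto simp: zero permutes_id finite_permutations)
  also have "\<dots> = 1" by (simp add: diag)
  finally show ?thesis .
qed

text \<open>The indicator of the set of vertices whose orbit misses the root is in the kernel.\<close>

lemma det_graph_mat_cyclic:
  assumes r: "r < m" and g: "g \<in> {0..<m} - {r} \<rightarrow>\<^sub>E {0..<m}" and ng: "g \<notin> forests {0..<m} {r}"
  shows "Determinant.det (graph_mat m r g) = 0"
proof -
  \<comment> \<open>Making the root a fixed point turns reaching \<open>r\<close> into a property of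
    the iterates of one map.\<close>
  define h where "h i = (if i = r then r else g i)" for i
  define H where "H i \<longleftrightarrow> (\<exists>k. (h ^^ k) i = r)" for i
  have Hr: "H r" unfolding H_def by (rule exI[of _ 0]) simp
  have Hg: "H i \<longleftrightarrow> H (g i)" if ir: "i \<noteq> r" for i
  proof
    assume "H i"
    then obtain k where k: "(h ^^ k) i = r" by (auto simp: H_def)
    then obtain k' where "k = Suc k'" using ir by (cases k) auto
    then have "(h ^^ k') (g i) = r" using k that by (simp add: funpow_Suc_right h_def del: funpow.simps)
    then show "H (g i)" by (auto simp: H_def)
  next
    assume "H (g i)"
    then obtain k where "(h ^^ k) (g i) = r" by (auto simp: H_def)
    then have "(h ^^ Suc k) i = r" using that by (simp add: funpow_Suc_right h_def del: funpow.simps)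
    then show "H i" unfolding H_def by blast
  qed
  have "\<exists>i<m. \<not> H i"
  proof (rule ccontr)
    assume "\<not> (\<exists>i<m. \<not> H i)"
    then have all: "\<And>i. i < m \<Longrightarrow> H i" by blast
    \<comment> \<open>If every orbit reached \<open>r\<close>, the number of steps to
      \<open>r\<close> would be a potential for \<open>g\<close>.\<close>
    define d where "d i = (LEAST k. (h ^^ k) i = r)" for i
    have "d (g i) < d i" if i: "i < m" "i \<noteq> r" for i
    proof -
      have "(h ^^ d i) i = r" unfolding d_def using all[OF i(1)] unfolding H_def by (rule LeastI_ex)
      then obtain k where k: "d i = Suc k" "(h ^^ Suc k) i = r" using i by (cases "d i") auto
      then have "(h ^^ k) (g i) = r" using i by (simp add: funpow_Suc_right h_def del: funpow.simps)
      then have "d (g i) \<le> k" unfolding d_def by (rule Least_le)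
      then show ?thesis using k by simp
    qed
    then have "g \<in> forests {0..<m} {r}" using g unfolding forests_def by (auto intro!: exI[of _ d])
    then show False using ng by blast
  qed
  then obtain c where c: "c < m" "\<not> H c" by blast
  define v :: "real vec" where "v = vec m (\<lambda>i. of_bool (\<not> H i))"
  have "v $ c \<noteq> 0" using c by (simp add: v_def)
  then have v0: "v \<noteq> 0\<^sub>v m" using c by auto
  have "graph_mat m r g *\<^sub>v v = 0\<^sub>v m"
  proof (rule eq_vecI)
    fix i assume "i < dim_vec (0\<^sub>v m)"
    then have i: "i < m" by simp
    have "(graph_mat m r g *\<^sub>v v) $ i = (\<Sum>j = 0..<m. graph_mat m r g $$ (i, j) * of_bool (\<not> H j))"
      using i by (simp add: scalar_prod_def v_def graph_mat_def)
    also have "\<dots> = 0"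
    proof (cases "i = r")
      case True
      have "(\<Sum>j = 0..<m. graph_mat m r g $$ (i, j) * of_bool (\<not> H j)) =
          (\<Sum>j = 0..<m. (if j = r then of_bool (\<not> H j) else 0))"
        using i True by (intro sum.cong) (auto simp: graph_mat_def)
      then show ?thesis using Hr by (simp add: sum.delta)
    next
      case False
      have gi: "g i < m" using g i False by (auto simp: PiE_iff)
      have "(\<Sum>j = 0..<m. graph_mat m r g $$ (i, j) * of_bool (\<not> H j)) =
          (\<Sum>j = 0..<m. (if j = i then of_bool (\<not> H j) else 0) - (if j = g i then of_bool (\<not> H j) else 0))"
        using i False by (intro sum.cong) (auto simp: graph_mat_def)
      also have "\<dots> = of_bool (\<not> H i) - of_bool (\<not> H (g i))"
        using i gi by (simp add: sum_subtractf sum.delta)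
      finally show ?thesis using Hg[OF False] by simp
    qed
    finally show "(graph_mat m r g *\<^sub>v v) $ i = 0\<^sub>v m $ i" using i by simp
  qed (simp add: graph_mat_def)
  moreover have "v \<in> carrier_vec m" by (simp add: v_def)
  ultimately show ?thesis using v0 det_0_iff_vec_prod_zero[OF graph_mat_carrier] by blast
qed

section \<open>Cofactors of a weighted Laplacian\<close>

definition lap :: "nat \<Rightarrow> (nat \<Rightarrow> nat \<Rightarrow> real) \<Rightarrow> real mat" where
  "lap m u = mat m m (\<lambda>(i, j). if i = j then \<Sum>t\<in>{0..<m} - {i}. u i t else - u i j)"

lemma lap_carrier [simp]: "lap m u \<in> carrier_mat m m"
  by (simp add: lap_def)

text \<open>The term \<open>t = i\<close> vanishes, so the sum may run over all targets although the
  diagonal of \<open>lap\<close> leaves \<open>u i i\<close> out. Choosing one target per row then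
  yields arbitrary functions \<open>g\<close>, loops included.\<close>

lemma lap_entry:
  assumes "i < m" "j < m"
  shows "lap m u $$ (i, j) = (\<Sum>t = 0..<m. u i t * (of_bool (j = i) - of_bool (j = t)))"
proof -
  have "(\<Sum>t = 0..<m. u i t * (of_bool (j = i) - of_bool (j = t))) =
      (\<Sum>t = 0..<m. of_bool (j = i) * u i t) - (\<Sum>t = 0..<m. if t = j then u i t else 0)"
    unfolding sum_subtractf[symmetric] by (intro sum.cong) (auto simp: algebra_simps)
  also have "\<dots> = lap m u $$ (i, j)"
    using assms by (auto simp: lap_def sum.delta sum_diff1)
  finally show ?thesis ..
qed

text \<open>Expand every row other than \<open>r\<close> as \<open>\<Sum>t. u i t * (e i - e t)\<close> and use multilinearity.\<close>

lemma det_lap_cofactor: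
  assumes r: "r < m"
  shows "cofactor (lap m u) r r = (\<Sum>g\<in>forests {0..<m} {r}. \<Prod>i\<in>{0..<m} - {r}. u i (g i))"
proof -
  \<comment> \<open>A unit row at \<open>r\<close> turns the cofactor into a full determinant, to
    which the Leibniz formula applies.\<close>
  define N where "N = mat m m (\<lambda>(i, j). if i = r then of_bool (j = r) else lap m u $$ (i, j))"
  have Nc: "N \<in> carrier_mat m m" by (simp add: N_def)
  let ?X = "{0..<m} - {r}"
  have "Determinant.det N = (\<Sum>j<m. N $$ (r, j) * cofactor N r j)"
    by (rule laplace_expansion_row[OF Nc r])
  also have "\<dots> = (\<Sum>j<m. if j = r then cofactor N r j else 0)"
    using r by (intro sum.cong) (auto simp: N_def)
  also have "\<dots> = cofactor N r r" using r by (simp add: sum.delta)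
  also have "mat_delete N r r = mat_delete (lap m u) r r"
    by (rule eq_matI) (auto simp: mat_delete_def N_def lap_def)
  then have "cofactor N r r = cofactor (lap m u) r r" by (simp add: cofactor_def)
  finally have dN: "cofactor (lap m u) r r = Determinant.det N" ..
  let ?P = "{p. p permutes {0..<m}}"
  have expand: "(\<Prod>i = 0..<m. N $$ (i, p i)) =
      (\<Sum>g\<in>?X \<rightarrow>\<^sub>E {0..<m}. (\<Prod>i\<in>?X. u i (g i)) * (\<Prod>i = 0..<m. graph_mat m r g $$ (i, p i)))"
    if "p permutes {0..<m}" for p
  proof -
    have pm: "p i < m" if "i < m" for i
      using permutes_in_image[OF \<open>p permutes _\<close>, of i] that by simp
    have split: "(\<Prod>i = 0..<m. F i) = F r * (\<Prod>i\<in>?X. F i)" for F :: "nat \<Rightarrow> real"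
      using r by (simp add: prod.remove)
    have "(\<Prod>i = 0..<m. N $$ (i, p i)) = of_bool (p r = r) *
        (\<Prod>i\<in>?X. \<Sum>t = 0..<m. u i t * (of_bool (p i = i) - of_bool (p i = t)))"
      unfolding split using r pm
      by (intro arg_cong2[of _ _ _ _ "(*)"] prod.cong) (auto simp: N_def lap_entry)
    also have "\<dots> = (\<Sum>g\<in>?X \<rightarrow>\<^sub>E {0..<m}. of_bool (p r = r) *
        (\<Prod>i\<in>?X. u i (g i) * (of_bool (p i = i) - of_bool (p i = g i))))"
      by (subst prod_sum_PiE) (auto simp: sum_distrib_left)
    also have "\<dots> = (\<Sum>g\<in>?X \<rightarrow>\<^sub>E {0..<m}. (\<Prod>i\<in>?X. u i (g i)) * (\<Prod>i = 0..<m. graph_mat m r g $$ (i, p i)))"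
    proof (rule sum.cong)
      fix g
      have "(\<Prod>i\<in>?X. of_bool (p i = i) - of_bool (p i = g i)) = (\<Prod>i\<in>?X. graph_mat m r g $$ (i, p i))"
        using pm by (intro prod.cong) (auto simp: graph_mat_def)
      moreover have "graph_mat m r g $$ (r, p r) = of_bool (p r = r)"
        using r pm by (simp add: graph_mat_def)
      ultimately show "of_bool (p r = r) * (\<Prod>i\<in>?X. u i (g i) * (of_bool (p i = i) - of_bool (p i = g i))) =
        (\<Prod>i\<in>?X. u i (g i)) * (\<Prod>i = 0..<m. graph_mat m r g $$ (i, p i))"
        unfolding split by (simp add: prod.distrib)
    qed simp
    finally show ?thesis .
  qed
  have "Determinant.det N = (\<Sum>p\<in>?P. signof p * (\<Prod>i = 0..<m. N $$ (i, p i)))"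
    by (rule det_def'[OF Nc])
  also have "\<dots> = (\<Sum>p\<in>?P. \<Sum>g\<in>?X \<rightarrow>\<^sub>E {0..<m}.
      (\<Prod>i\<in>?X. u i (g i)) * (signof p * (\<Prod>i = 0..<m. graph_mat m r g $$ (i, p i))))"
    by (rule sum.cong[OF refl]) (simp add: expand sum_distrib_left mult_ac)
  also have "\<dots> = (\<Sum>g\<in>?X \<rightarrow>\<^sub>E {0..<m}. (\<Prod>i\<in>?X. u i (g i)) * Determinant.det (graph_mat m r g))"
    by (subst sum.swap) (simp add: det_def'[OF graph_mat_carrier] sum_distrib_left)
  \<comment> \<open>Functions with a cycle have determinant 0, which leaves the trees rooted at
    \<open>r\<close>, each with determinant 1.\<close>
  also have "\<dots> = (\<Sum>g\<in>forests {0..<m} {r}. (\<Prod>i\<in>?X. u i (g i)) * Determinant.det (graph_mat m r g))"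
  proof (rule sum.mono_neutral_right)
    show "finite (?X \<rightarrow>\<^sub>E {0..<m})" by (intro finite_PiE) auto
    show "forests {0..<m} {r} \<subseteq> ?X \<rightarrow>\<^sub>E {0..<m}" by (auto simp: forests_def)
  qed (use r in \<open>auto simp: det_graph_mat_cyclic\<close>)
  also have "\<dots> = (\<Sum>g\<in>forests {0..<m} {r}. \<Prod>i\<in>?X. u i (g i))"
    using r by (intro sum.cong) (simp_all add: det_graph_mat_acyclic)
  finally show ?thesis using dN by simp
qed

text \<open>Put the difference of the unit vectors at \<open>c\<close> and \<open>c'\<close> into
  row \<open>r\<close>: the determinant becomes the difference of the two cofactors, while all rows
  still sum to zero, so the all-ones vector lies in the kernel.\<close>

lemma cofactor_row_sums_zero:
  fixes A :: "real mat"
  assumes A: "A \<in> carrier_mat m m" and rows: "\<And>i. i < m \<Longrightarrow> (\<Sum>j = 0..<m. A $$ (i, j)) = 0"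
    and r: "r < m" and c: "c < m" "c' < m"
  shows "cofactor A r c = cofactor A r c'"
proof (cases "c = c'")
  case False
  define B where "B = mat m m (\<lambda>(i, j). if i = r then of_bool (j = c) - of_bool (j = c') else A $$ (i, j))"
  have Bc: "B \<in> carrier_mat m m" by (simp add: B_def)
  have "Determinant.det B = (\<Sum>j<m. B $$ (r, j) * cofactor B r j)"
    by (rule laplace_expansion_row[OF Bc r])
  also have "\<dots> = (\<Sum>j<m. (if j = c then cofactor B r j else 0) - (if j = c' then cofactor B r j else 0))"
    using r False by (intro sum.cong) (auto simp: B_def)
  also have "\<dots> = cofactor B r c - cofactor B r c'"
    using c by (simp add: sum_subtractf sum.delta)
  also have "mat_delete B r j = mat_delete A r j" if "j < m" for j
    using A that r by (intro eq_matI) (auto simp: mat_delete_def B_def)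
  then have "cofactor B r c - cofactor B r c' = cofactor A r c - cofactor A r c'"
    using c by (simp add: cofactor_def)
  finally have "Determinant.det B = cofactor A r c - cofactor A r c'" .
  moreover have "Determinant.det B = 0"
  proof -
    define v :: "real vec" where "v = vec m (\<lambda>i. 1)"
    have "B *\<^sub>v v = 0\<^sub>v m"
    proof (rule eq_vecI)
      fix i assume "i < dim_vec (0\<^sub>v m)"
      then have i: "i < m" by simp
      have "(B *\<^sub>v v) $ i = (\<Sum>j = 0..<m. B $$ (i, j))"
        using i by (simp add: scalar_prod_def v_def B_def)
      also have "\<dots> = 0"
      proof (cases "i = r")
        case True
        then have "(\<Sum>j = 0..<m. B $$ (i, j)) = (\<Sum>j = 0..<m. of_bool (j = c) - of_bool (j = c'))"
          using i by (intro sum.cong) (auto simp: B_def)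
        then show ?thesis using c by (simp add: sum_subtractf of_bool_def sum.delta)
      next
        case False
        then have "(\<Sum>j = 0..<m. B $$ (i, j)) = (\<Sum>j = 0..<m. A $$ (i, j))"
          using i by (intro sum.cong) (auto simp: B_def)
        then show ?thesis using rows[OF i] by simp
      qed
      finally show "(B *\<^sub>v v) $ i = 0\<^sub>v m $ i" using i by simp
    qed (simp add: B_def)
    moreover have "v $ r \<noteq> 0" using r by (simp add: v_def)
    then have "v \<noteq> 0\<^sub>v m" using r by auto
    moreover have "v \<in> carrier_vec m" by (simp add: v_def)
    ultimately show ?thesis using det_0_iff_vec_prod_zero[OF Bc] by blast
  qed
  ultimately show ?thesis by simp
qed simp

lemma cofactor_transpose:
  assumes A: "A \<in> carrier_mat m m" and "i < m" "j < m"
  shows "cofactor (transpose_mat A) i j = cofactor A j i"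
proof -
  have "mat_delete (transpose_mat A) i j = transpose_mat (mat_delete A j i)"
    using assms by (intro eq_matI) (auto simp: mat_delete_def)
  moreover have "mat_delete A j i \<in> carrier_mat (m - 1) (m - 1)"
    by (rule mat_delete_carrier[OF A])
  ultimately show ?thesis by (simp add: cofactor_def Determinant.det_transpose add.commute)
qed

text \<open>Zero row sums let the column index of a cofactor change, and symmetry swaps the two
  indices: \<open>(r, r)\<close>, \<open>(r, s)\<close>, \<open>(s, r)\<close>,
  \<open>(s, s)\<close>.\<close>

lemma cofactor_lap_root_independent:
  assumes sym: "\<And>i j. u i j = u j i" and r: "r < m" and s: "s < m"
  shows "cofactor (lap m u) r r = cofactor (lap m u) s s"
proof -
  have T: "transpose_mat (lap m u) = lap m u"
    by (rule eq_matI) (auto simp: lap_def sym)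
  have rows: "(\<Sum>j = 0..<m. lap m u $$ (i, j)) = 0" if i: "i < m" for i
  proof -
    have "(\<Sum>j = 0..<m. lap m u $$ (i, j)) = lap m u $$ (i, i) + (\<Sum>j\<in>{0..<m} - {i}. lap m u $$ (i, j))"
      using i by (simp add: sum.remove)
    also have "(\<Sum>j\<in>{0..<m} - {i}. lap m u $$ (i, j)) = (\<Sum>j\<in>{0..<m} - {i}. - u i j)"
      using i by (intro sum.cong) (auto simp: lap_def)
    finally show ?thesis using i by (simp add: lap_def sum_negf)
  qed
  have "cofactor (lap m u) r r = cofactor (lap m u) r s"
    by (rule cofactor_row_sums_zero[OF lap_carrier rows r r s])
  also have "\<dots> = cofactor (lap m u) s r"
    using cofactor_transpose[OF lap_carrier s r, of u] by (simp add: T)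
  also have "\<dots> = cofactor (lap m u) s s"
    by (rule cofactor_row_sums_zero[OF lap_carrier rows s r s])
  finally show ?thesis .
qed

text \<open>The minor deletes the least vertex, but all principal cofactors of a symmetric Laplacian
  agree, so any vertex may serve as root. The rest is transport between vertices and their positions
  in the sorted list.\<close>

lemma laplacian_minor_forests:
  assumes sym: "\<And>i j. w i j = w j i" and fin: "finite V" and r: "r \<in> V"
  shows "laplacian_minor w V = (\<Sum>g\<in>forests V {r}. \<Prod>i\<in>V - {r}. w i (g i))"
proof -
  define m where "m = card V"
  define e where "e i = sorted_list_of_set V ! i" for i
  define u where "u i j = w (e i) (e j)" for i j
  have bij: "bij_betw e {0..<m} V"
    unfolding e_def by (rule bij_betw_nth) (use fin in \<open>auto simp: m_def lessThan_atLeast0\<close>)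
  have inj: "inj_on e {0..<m}" and img: "e ` {0..<m} = V" using bij by (auto simp: bij_betw_def)
  obtain k where k: "k < m" "e k = r" using img r by auto
  define e' where "e' = inv_into {0..<m} e"
  have e': "e' x < m" "e (e' x) = x" if "x \<in> V" for x
    using that img inv_into_into[of x e "{0..<m}"] f_inv_into_f[of x e "{0..<m}"]
    by (auto simp: e'_def)
  have e'e: "e' (e i) = i" if "i < m" for i using that inj by (simp add: e'_def)
  have eV: "e i \<in> V" if "i < m" for i using img that by auto
  have "laplacian w V = lap m u"
  proof (rule eq_matI)
    fix i j assume "i < dim_row (lap m u)" "j < dim_col (lap m u)"
    then have ij: "i < m" "j < m" by (auto simp: lap_def)
    have "(\<Sum>t\<in>V - {e i}. w (e i) t) = (\<Sum>t\<in>{0..<m} - {i}. w (e i) (e t))"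
      using e' e'e eV ij
      by (intro sum.reindex_bij_witness[of _ e e']) (auto dest!: inj_onD[OF inj])
    then show "laplacian w V $$ (i, j) = lap m u $$ (i, j)"
      using ij by (auto simp: laplacian_def lap_def Let_def m_def[symmetric] e_def[symmetric] u_def)
  qed (auto simp: laplacian_def lap_def Let_def m_def)
  then have "laplacian_minor w V = cofactor (lap m u) 0 0"
    by (simp add: laplacian_minor_def cofactor_def)
  also have "\<dots> = cofactor (lap m u) k k"
    using k sym by (intro cofactor_lap_root_independent) (auto simp: u_def)
  also have "\<dots> = (\<Sum>g\<in>forests {0..<m} {k}. \<Prod>i\<in>{0..<m} - {k}. u i (g i))"
    by (rule det_lap_cofactor[OF k(1)])
  also have "\<dots> = (\<Sum>g\<in>forests V {r}. \<Prod>i\<in>V - {r}. w i (g i))"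
  \<comment> \<open>Parent functions are conjugated by the enumeration \<open>e\<close> and its
    inverse \<open>e'\<close>; potentials are carried along by composition.\<close>
  proof (rule sum.reindex_bij_witness[of _ "\<lambda>g. \<lambda>i\<in>{0..<m} - {k}. e' (g (e i))"
        "\<lambda>g. \<lambda>x\<in>V - {r}. e (g (e' x))"])
    have ek: "e i = r \<longleftrightarrow> i = k" if "i < m" for i
      using inj that k by (auto simp: inj_on_def)
    have e'k: "e' x = k \<longleftrightarrow> x = r" if "x \<in> V" for x
      using e'[OF that] e'e k by auto
    {
      fix g assume g: "g \<in> forests {0..<m} {k}"
      have gm: "g i < m" if "i < m" "i \<noteq> k" for i using g that by (auto simp: forests_def PiE_iff)
      have gu: "g i = undefined" if "\<not> (i < m \<and> i \<noteq> k)" for i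
        using g that by (auto simp: forests_def PiE_iff extensional_def)
      obtain d :: "nat \<Rightarrow> nat" where d: "\<And>i. i < m \<Longrightarrow> i \<noteq> k \<Longrightarrow> d (g i) < d i"
        using forestsE[OF g] by auto
      show "(\<lambda>i\<in>{0..<m} - {k}. e' ((\<lambda>x\<in>V - {r}. e (g (e' x))) (e i))) = g"
        by (rule ext) (auto simp: restrict_def eV ek e'e gm gu)
      have "d (e' (e (g (e' x)))) < d (e' x)" if "x \<in> V" "x \<noteq> r" for x
        using e'(1)[OF that(1)] e'k[OF that(1)] that(2) gm d e'e by simp
      then show "(\<lambda>x\<in>V - {r}. e (g (e' x))) \<in> forests V {r}"
        unfolding forests_def using e' e'k gm eV
        by (auto intro!: exI[of _ "\<lambda>x. d (e' x)"])
      show "(\<Prod>i\<in>V - {r}. w i ((\<lambda>x\<in>V - {r}. e (g (e' x))) i)) = (\<Prod>i\<in>{0..<m} - {k}. u i (g i))"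
        using e' e'e eV ek e'k
        by (intro prod.reindex_bij_witness[of _ e e']) (auto simp: u_def)
    }
    fix h assume h: "h \<in> forests V {r}"
    have hV: "h x \<in> V" if "x \<in> V" "x \<noteq> r" for x using h that by (auto simp: forests_def PiE_iff)
    have hu: "h x = undefined" if "\<not> (x \<in> V \<and> x \<noteq> r)" for x
      using h that by (auto simp: forests_def PiE_iff extensional_def)
    obtain d :: "nat \<Rightarrow> nat" where d: "\<And>x. x \<in> V \<Longrightarrow> x \<noteq> r \<Longrightarrow> d (h x) < d x"
      using forestsE[OF h] by auto
    show "(\<lambda>x\<in>V - {r}. e ((\<lambda>i\<in>{0..<m} - {k}. e' (h (e i))) (e' x))) = h"
      by (rule ext) (auto simp: restrict_def e' e'k hV hu)
    show "(\<lambda>i\<in>{0..<m} - {k}. e' (h (e i))) \<in> forests {0..<m} {k}"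
    proof (rule forestsI[where d = "\<lambda>i. d (e i)"])
      fix i assume "i \<in> {0..<m}" "i \<notin> {k}"
      then show "d (e ((\<lambda>i\<in>{0..<m} - {k}. e' (h (e i))) i)) < d (e i)"
        using eV[of i] ek[of i] hV d e' by simp
    qed (use e' ek hV eV in auto)
  qed
  finally show ?thesis .
qed

section \<open>Forests and partitions\<close>

text \<open>Root sets may reach outside \<open>V\<close> and only their trace on \<open>V\<close>
  counts, so one global root set can serve all blocks at once.\<close>

lemma forests_cong: "V - S = V - S' \<Longrightarrow> forests V S = forests V S'"
  by (simp add: forests_def)

text \<open>A vertex of least potential cannot have a parent, so it is a root.\<close>

lemma forests_meet_roots:
  assumes g: "g \<in> forests V T" and ne: "V \<noteq> {}"
  shows "T \<inter> V \<noteq> {}"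
proof -
  obtain d :: "'a \<Rightarrow> nat" where d: "\<And>i. i \<in> V \<Longrightarrow> i \<notin> T \<Longrightarrow> d (g i) < d i"
    using forestsE[OF g] by blast
  obtain x where x: "x \<in> V" and mn: "\<And>y. y \<in> V \<Longrightarrow> d x \<le> d y"
    using ne ex_has_least_nat[of "\<lambda>x. x \<in> V" _ d] by blast
  have "x \<in> T"
  proof (rule ccontr)
    assume "x \<notin> T"
    moreover have "g x \<in> V" using g x \<open>x \<notin> T\<close> by (auto simp: forests_def PiE_iff)
    ultimately show False using d[OF x] mn[of "g x"] by simp
  qed
  then show ?thesis using x by blast
qed

text \<open>Point every root other than \<open>r\<close> to \<open>r\<close>.\<close>

lemma forests_merge_roots:
  fixes w :: "'a \<Rightarrow> 'a \<Rightarrow> real"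
  assumes fin: "finite V" and r: "r \<in> T" "r \<in> V"
    and w: "\<And>i j. 0 \<le> w i j" and b: "0 \<le> b"
    and lower: "\<And>i. i \<in> V \<Longrightarrow> i \<noteq> r \<Longrightarrow> 1 \<le> b * w i r"
  shows "(\<Sum>h\<in>forests V T. \<Prod>i\<in>V - T. w i (h i)) \<le>
    b ^ (card (T \<inter> V) - 1) * (\<Sum>g\<in>forests V {r}. \<Prod>i\<in>V - {r}. w i (g i))"
  unfolding sum_distrib_left
\<comment> \<open>Restriction to \<open>V - T\<close> recovers \<open>h\<close> from the tree built
  out of it, so distinct forests use distinct trees on the right.\<close>
proof (rule sum_le_included[where i = "\<lambda>g. restrict g (V - T)"], goal_cases)
  case 4
  show ?case
  proof
    fix h assume h: "h \<in> forests V T"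
    define g where "g = (\<lambda>i\<in>V - {r}. if i \<in> T then r else h i)"
    have hV: "h i \<in> V" if "i \<in> V" "i \<notin> T" for i using h that by (auto simp: forests_def PiE_iff)
    obtain d :: "'a \<Rightarrow> nat" where d: "\<And>i. i \<in> V \<Longrightarrow> i \<notin> T \<Longrightarrow> d (h i) < d i"
      using forestsE[OF h] by blast
    \<comment> \<open>Shifting \<open>d\<close> by one frees the value 0 for \<open>r\<close>, below
      all redirected roots.\<close>
    have "g \<in> forests V {r}"
      unfolding forests_def g_def using r hV d
      by (auto intro!: exI[of _ "\<lambda>i. if i = r then 0 else Suc (d i)"])
    moreover have "restrict g (V - T) = h"
      using h r by (intro ext) (auto simp: g_def forests_def PiE_iff extensional_def)
    moreover have "(\<Prod>i\<in>V - T. w i (h i)) \<le> b ^ (card (T \<inter> V) - 1) * (\<Prod>i\<in>V - {r}. w i (g i))"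
    proof -
      have un: "V - {r} = (V - T) \<union> (T \<inter> V - {r})" using r by auto
      have "(\<Prod>i\<in>V - {r}. w i (g i)) = (\<Prod>i\<in>V - T. w i (g i)) * (\<Prod>i\<in>T \<inter> V - {r}. w i (g i))"
        unfolding un using fin by (intro prod.union_disjoint) auto
      also have "(\<Prod>i\<in>V - T. w i (g i)) = (\<Prod>i\<in>V - T. w i (h i))"
        using r by (intro prod.cong) (auto simp: g_def)
      also have "(\<Prod>i\<in>T \<inter> V - {r}. w i (g i)) = (\<Prod>i\<in>T \<inter> V - {r}. w i r)"
        by (intro prod.cong) (auto simp: g_def)
      \<comment> \<open>Each redirected root pays for its new edge with one factor \<open>b\<close>;
        \<open>r\<close> itself gets no edge, hence the exponent is one less than the number of
        roots.\<close>
      finally have eq: "b ^ (card (T \<inter> V) - 1) * (\<Prod>i\<in>V - {r}. w i (g i)) =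
          (\<Prod>i\<in>V - T. w i (h i)) * (\<Prod>i\<in>T \<inter> V - {r}. b * w i r)"
        using fin r by (simp add: prod.distrib)
      have "1 \<le> (\<Prod>i\<in>T \<inter> V - {r}. b * w i r)"
        by (rule prod_ge_1) (use lower in auto)
      moreover have "0 \<le> (\<Prod>i\<in>V - T. w i (h i))" using w by (auto intro: prod_nonneg)
      ultimately show ?thesis unfolding eq
        using mult_left_mono[of 1 "\<Prod>i\<in>T \<inter> V - {r}. b * w i r"] by fastforce
    qed
    ultimately show "\<exists>g\<in>forests V {r}. restrict g (V - T) = h \<and>
        (\<Prod>i\<in>V - T. w i (h i)) \<le> b ^ (card (T \<inter> V) - 1) * (\<Prod>i\<in>V - {r}. w i (g i))"
      by blast
  qed
qed (use fin w b in \<open>auto intro!: mult_nonneg_nonneg prod_nonneg\<close>)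

text \<open>One parent function on all of \<open>N\<close> encodes a forest in every block, so that
  forests of different partitions can be compared. \<open>T\<close> may meet a block in any number
  of vertices.\<close>

definition block_forests :: "'a set \<Rightarrow> 'a set set \<Rightarrow> 'a set \<Rightarrow> ('a \<Rightarrow> 'a) set" where
  "block_forests N P T = {g \<in> forests N T. \<forall>V\<in>P. \<forall>i\<in>V - T. g i \<in> V}"

lemma finite_block_forests [simp]: "finite N \<Longrightarrow> finite (block_forests N P T)"
  by (simp add: block_forests_def)

lemma block_forests_restrict:
  assumes P: "partition_on N P" and g: "g \<in> block_forests N P T" and V: "V \<in> P"
  shows "restrict g (V - T) \<in> forests V T"
proof -
  have gf: "g \<in> forests N T" using g by (simp add: block_forests_def)
  obtain d :: "'a \<Rightarrow> nat" where d: "\<And>i. i \<in> N \<Longrightarrow> i \<notin> T \<Longrightarrow> d (g i) < d i"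
    using forestsE[OF gf] by blast
  have "V \<subseteq> N" using P V by (auto simp: partition_on_def)
  then show ?thesis using g V d unfolding forests_def block_forests_def by auto
qed

text \<open>Distribute the product over the sums and glue the chosen forests. Edges stay inside
  blocks, so the separate potentials glue as well.\<close>

lemma prod_forests_blocks:
  fixes w :: "'a \<Rightarrow> 'a \<Rightarrow> real"
  assumes P: "partition_on N P" and fin: "finite N"
  shows "(\<Prod>V\<in>P. \<Sum>h\<in>forests V T. \<Prod>i\<in>V - T. w i (h i)) =
    (\<Sum>g\<in>block_forests N P T. \<Prod>i\<in>N - T. w i (g i))"
proof -
  have finP: "finite P" using fin P by (rule finite_elements)
  have sub: "V \<subseteq> N" if "V \<in> P" for V using P that by (auto simp: partition_on_def)
  have finV: "finite V" if "V \<in> P" for V using sub[OF that] fin finite_subset by blast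
  have disj: "V = V'" if "V \<in> P" "V' \<in> P" "i \<in> V" "i \<in> V'" for V V' i
    using P that by (auto simp: partition_on_def disjoint_def)
  define blk where "blk i = (THE V. V \<in> P \<and> i \<in> V)" for i
  have blk_eq: "blk i = V" if "V \<in> P" "i \<in> V" for i V
    unfolding blk_def using that disj by (intro the_equality) auto
  have blk: "blk i \<in> P" "i \<in> blk i" if i: "i \<in> N" for i
  proof -
    obtain V where "V \<in> P" "i \<in> V" using P i by (auto simp: partition_on_def)
    then show "blk i \<in> P" "i \<in> blk i" using blk_eq by auto
  qed
  have W: "(\<Prod>V\<in>P. \<Prod>i\<in>V - T. F i) = (\<Prod>i\<in>N - T. F i)" for F :: "'a \<Rightarrow> real"
  proof -
    have "N - T = (\<Union>V\<in>P. V - T)" using P by (auto simp: partition_on_def)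
    then show ?thesis
      using finP finV disj by (simp only:, subst prod.UNION_disjoint) blast+
  qed
  have "(\<Prod>V\<in>P. \<Sum>h\<in>forests V T. \<Prod>i\<in>V - T. w i (h i)) =
      (\<Sum>H\<in>PiE P (\<lambda>V. forests V T). \<Prod>V\<in>P. \<Prod>i\<in>V - T. w i (H V i))"
    by (rule prod_sum_PiE) (simp_all add: finP finV)
  also have "\<dots> = (\<Sum>g\<in>block_forests N P T. \<Prod>i\<in>N - T. w i (g i))"
  proof (rule sum.reindex_bij_witness[of _ "\<lambda>g. \<lambda>V\<in>P. restrict g (V - T)"
        "\<lambda>H. \<lambda>i\<in>N - T. H (blk i) i"])
    fix g assume g: "g \<in> block_forests N P T"
    have ext: "g i = undefined" if "\<not> (i \<in> N \<and> i \<notin> T)" for i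
      using g that by (auto simp: block_forests_def forests_def PiE_iff extensional_def)
    show "(\<lambda>i\<in>N - T. (\<lambda>V\<in>P. restrict g (V - T)) (blk i) i) = g"
      using blk ext by (intro HOL.ext) (auto simp: restrict_def)
    show "(\<lambda>V\<in>P. restrict g (V - T)) \<in> PiE P (\<lambda>V. forests V T)"
      using block_forests_restrict[OF P g] by auto
  next
    fix H assume H: "H \<in> PiE P (\<lambda>V. forests V T)"
    have Hf: "H V \<in> forests V T" if "V \<in> P" for V using H that by auto
    have Hext: "H V i = undefined" if "V \<in> P" "\<not> (i \<in> V \<and> i \<notin> T)" for V i
      using Hf[OF that(1)] that(2) by (auto simp: forests_def PiE_iff extensional_def)
    have HV: "H V i \<in> V" if "V \<in> P" "i \<in> V" "i \<notin> T" for V i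
      using Hf[OF that(1)] that(2,3) by (auto simp: forests_def PiE_iff)
    show "(\<lambda>V\<in>P. restrict (\<lambda>i\<in>N - T. H (blk i) i) (V - T)) = H"
    proof
      fix V
      show "(\<lambda>V\<in>P. restrict (\<lambda>i\<in>N - T. H (blk i) i) (V - T)) V = H V"
      proof (cases "V \<in> P")
        case True
        then show ?thesis using blk_eq sub Hext by (intro HOL.ext) (auto simp: restrict_def)
      next
        case False
        then show ?thesis using H by (auto simp: PiE_iff extensional_def)
      qed
    qed
    have "\<exists>d :: 'a \<Rightarrow> nat. \<forall>i\<in>V - T. d (H V i) < d i" if "V \<in> P" for V
      using Hf[OF that] by (simp add: forests_def)
    then obtain D :: "'a set \<Rightarrow> 'a \<Rightarrow> nat"
      where D: "\<And>V i. V \<in> P \<Longrightarrow> i \<in> V - T \<Longrightarrow> D V (H V i) < D V i" by metis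
    show "(\<lambda>i\<in>N - T. H (blk i) i) \<in> block_forests N P T"
      unfolding block_forests_def forests_def
    proof (intro CollectI conjI exI[of _ "\<lambda>i. D (blk i) i"] ballI)
      show "(\<lambda>i\<in>N - T. H (blk i) i) \<in> N - T \<rightarrow>\<^sub>E N"
      proof -
        have "H (blk x) x \<in> N" if "x \<in> N" "x \<notin> T" for x
          using HV[of "blk x" x] blk[of x] sub[of "blk x"] that by blast
        then show ?thesis by auto
      qed
    next
      fix i assume i: "i \<in> N - T"
      have "blk (H (blk i) i) = blk i" using i blk HV by (intro blk_eq) auto
      then show "D (blk ((\<lambda>i\<in>N - T. H (blk i) i) i)) ((\<lambda>i\<in>N - T. H (blk i) i) i) < D (blk i) i"
        using i D blk by simp
    next
      fix V i assume "V \<in> P" "i \<in> V - T"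
      then show "(\<lambda>i\<in>N - T. H (blk i) i) i \<in> V" using HV sub blk_eq by auto
    qed
    have "(\<Prod>i\<in>N - T. w i ((\<lambda>i\<in>N - T. H (blk i) i) i)) = (\<Prod>i\<in>N - T. w i (H (blk i) i))"
      by (intro prod.cong) auto
    also have "\<dots> = (\<Prod>V\<in>P. \<Prod>i\<in>V - T. w i (H (blk i) i))"
      by (rule W[symmetric])
    also have "\<dots> = (\<Prod>V\<in>P. \<Prod>i\<in>V - T. w i (H V i))"
      by (intro prod.cong) (auto simp: blk_eq)
    finally show "(\<Prod>i\<in>N - T. w i ((\<lambda>i\<in>N - T. H (blk i) i) i)) = (\<Prod>V\<in>P. \<Prod>i\<in>V - T. w i (H V i))" .
  qed
  finally show ?thesis .
qed

text \<open>The blocks are the trees of the forest, hence determined by it.\<close>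

lemma block_forests_determine_partition:
  assumes P: "partition_on N P" and Q: "partition_on N Q"
    and gP: "g \<in> block_forests N P R" and gQ: "g \<in> block_forests N Q R"
    and oneP: "\<And>V. V \<in> P \<Longrightarrow> \<exists>s. R \<inter> V = {s}" and oneQ: "\<And>V. V \<in> Q \<Longrightarrow> \<exists>s. R \<inter> V = {s}"
  shows "P = Q"
proof -
  have gf: "g \<in> forests N R" using gP by (simp add: block_forests_def)
  obtain d :: "'a \<Rightarrow> nat" where d: "\<And>i. i \<in> N \<Longrightarrow> i \<notin> R \<Longrightarrow> d (g i) < d i"
    using forestsE[OF gf] by blast
  \<comment> \<open>Induction along parent edges: both blocks contain the parent of
    \<open>i\<close>, and at the end of the path both have the same single root.\<close>
  have same_root: "R \<inter> V = R \<inter> V'" if "V \<in> P" "V' \<in> Q" "i \<in> V" "i \<in> V'" for V V' i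
    using that
  proof (induction "d i" arbitrary: i rule: less_induct)
    case less
    show ?case
    proof (cases "i \<in> R")
      case True
      then have "i \<in> R \<inter> V" "i \<in> R \<inter> V'" using less.prems by auto
      moreover obtain s s' where "R \<inter> V = {s}" "R \<inter> V' = {s'}"
        using oneP[OF less.prems(1)] oneQ[OF less.prems(2)] by blast
      ultimately have "R \<inter> V = {i}" "R \<inter> V' = {i}" by auto
      then show ?thesis by simp
    next
      case False
      then have "g i \<in> V" "g i \<in> V'" using gP gQ less.prems by (auto simp: block_forests_def)
      moreover have "i \<in> N" using P less.prems by (auto simp: partition_on_def)
      ultimately show ?thesis using less d False by blast
    qed
  qed
  \<comment> \<open>Stated for arbitrary \<open>P\<close> and \<open>Q\<close>, since both
    inclusions are obtained from it by exchanging the partitions.\<close>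
  have sub: "V \<subseteq> V'" if P: "partition_on N P" and Q: "partition_on N Q"
    and one: "\<And>V. V \<in> Q \<Longrightarrow> \<exists>s. R \<inter> V = {s}"
    and same_root: "\<And>V V' i. V \<in> P \<Longrightarrow> V' \<in> Q \<Longrightarrow> i \<in> V \<Longrightarrow> i \<in> V' \<Longrightarrow> R \<inter> V = R \<inter> V'"
    and V: "V \<in> P" "V' \<in> Q" "i \<in> V" "i \<in> V'" for P Q V V' i
  proof
    fix x assume x: "x \<in> V"
    then obtain U where U: "U \<in> Q" "x \<in> U" using P Q V by (auto simp: partition_on_def)
    have "R \<inter> U = R \<inter> V'" using same_root[OF V(1) U(1) x U(2)] same_root[OF V] by simp
    then obtain s where "s \<in> U" "s \<in> V'" using one[OF V(2)] by auto
    then have "U = V'" using Q U V by (auto simp: partition_on_def disjoint_def)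
    then show "x \<in> V'" using U by simp
  qed
  have subset: "P \<subseteq> Q" if P: "partition_on N P" and Q: "partition_on N Q"
    and oneP: "\<And>V. V \<in> P \<Longrightarrow> \<exists>s. R \<inter> V = {s}" and oneQ: "\<And>V. V \<in> Q \<Longrightarrow> \<exists>s. R \<inter> V = {s}"
    and sr: "\<And>V V' i. V \<in> P \<Longrightarrow> V' \<in> Q \<Longrightarrow> i \<in> V \<Longrightarrow> i \<in> V' \<Longrightarrow> R \<inter> V = R \<inter> V'" for P Q
  proof
    fix V assume V: "V \<in> P"
    then have "V \<noteq> {}" "V \<subseteq> N" using P by (auto simp: partition_on_def)
    then obtain i where i: "i \<in> V" "i \<in> N" by blast
    then obtain V' where V': "V' \<in> Q" "i \<in> V'" using Q by (auto simp: partition_on_def)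
    have "V \<subseteq> V'" by (rule sub[OF P Q oneQ sr V V'(1) i(1) V'(2)])
    moreover have "V' \<subseteq> V"
      by (rule sub[OF Q P oneP _ V'(1) V V'(2) i(1)]) (assumption | rule sr[symmetric])+
    ultimately show "V \<in> Q" using V' by simp
  qed
  show ?thesis
  proof
    show "P \<subseteq> Q" by (rule subset[OF P Q oneP oneQ same_root])
    show "Q \<subseteq> P" by (rule subset[OF Q P oneQ oneP]) (assumption | rule same_root[symmetric])+
  qed
qed

section \<open>Root counts and weights of forests inside fixed blocks\<close>

lemma sum_le_inj_on:
  fixes f :: "'a \<Rightarrow> real" and F :: "'b \<Rightarrow> real"
  assumes "finite Y" "inj_on \<phi> X" "\<phi> ` X \<subseteq> Y"
    and "\<And>x. x \<in> X \<Longrightarrow> f x \<le> F (\<phi> x)" and "\<And>y. y \<in> Y \<Longrightarrow> 0 \<le> F y"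
  shows "sum f X \<le> sum F Y"
proof -
  have "sum f X \<le> (\<Sum>x\<in>X. F (\<phi> x))" using assms by (intro sum_mono)
  also have "\<dots> = sum F (\<phi> ` X)" using assms by (simp add: sum.reindex)
  also have "\<dots> \<le> sum F Y" using assms by (intro sum_mono2) auto
  finally show ?thesis .
qed

text \<open>The traces of \<open>T\<close> on the blocks are disjoint and nonempty. Their total
  excess over one vertex each counts the edges that merge every block to a single root; if it is 0,
  every trace is a single vertex.\<close>

lemma card_partition_meet:
  assumes P: "partition_on N P" and fin: "finite N" and T: "T \<subseteq> N"
    and meet: "\<And>V. V \<in> P \<Longrightarrow> T \<inter> V \<noteq> {}"
  shows "card P \<le> card T" "(\<Sum>V\<in>P. card (T \<inter> V) - 1) = card T - card P"
    "card T = card P \<Longrightarrow> V \<in> P \<Longrightarrow> card (T \<inter> V) = 1"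
proof -
  have finP: "finite P" using fin P by (rule finite_elements)
  have finT: "finite T" using T fin finite_subset by blast
  have ge: "1 \<le> card (T \<inter> V)" if "V \<in> P" for V
    using meet[OF that] finT by (simp add: Suc_le_eq card_gt_0_iff)
  have "T = (\<Union>V\<in>P. T \<inter> V)" using P T by (auto simp: partition_on_def)
  then have "card T = card (\<Union>V\<in>P. T \<inter> V)" by simp
  also have "\<dots> = (\<Sum>V\<in>P. card (T \<inter> V))"
    using P finP finT by (intro card_UN_disjoint) (auto simp: partition_on_def disjoint_def)
  finally have cT: "card T = (\<Sum>V\<in>P. card (T \<inter> V))" .
  have "(\<Sum>V\<in>P. card (T \<inter> V) - 1) = (\<Sum>V\<in>P. card (T \<inter> V)) - (\<Sum>V\<in>P. 1)"
    by (rule sum_subtractf_nat) (use ge in auto)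
  then show s: "(\<Sum>V\<in>P. card (T \<inter> V) - 1) = card T - card P" using cT by simp
  have "(\<Sum>V\<in>P. 1) \<le> (\<Sum>V\<in>P. card (T \<inter> V))" by (rule sum_mono) (use ge in auto)
  then show "card P \<le> card T" using cT by simp
  show "card (T \<inter> V) = 1" if "card T = card P" "V \<in> P"
  proof -
    have "(\<Sum>V\<in>P. card (T \<inter> V) - 1) = 0" using s that by simp
    then have "card (T \<inter> V) - 1 = 0" using finP that by (simp add: sum_eq_0_iff)
    then show ?thesis using ge[OF that(2)] by simp
  qed
qed

text \<open>Merging the roots inside each block costs one \<open>b\<close> per surplus root,
  \<open>card T - card P\<close> in total. A block missed by \<open>T\<close> admits no forest, and
  then the left side is 0.\<close>

lemma forests_blocks_bound:
  fixes w :: "nat \<Rightarrow> nat \<Rightarrow> real"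
  assumes P: "partition_on N P" and fin: "finite N" and T: "T \<subseteq> N"
    and w: "\<And>i j. 0 \<le> w i j" and sym: "\<And>i j. w i j = w j i" and b: "0 \<le> b"
    and within: "\<And>V i j. V \<in> P \<Longrightarrow> i \<in> V \<Longrightarrow> j \<in> V \<Longrightarrow> i \<noteq> j \<Longrightarrow> 1 \<le> b * w i j"
  shows "(\<Sum>g\<in>block_forests N P T. \<Prod>i\<in>N - T. w i (g i)) \<le>
    b ^ (card T - card P) * (\<Prod>V\<in>P. laplacian_minor w V)"
proof -
  have finP: "finite P" using fin P by (rule finite_elements)
  have finV: "finite V" if "V \<in> P" for V
    using P that fin by (auto simp: partition_on_def intro: finite_subset)
  have neV: "V \<noteq> {}" if "V \<in> P" for V using P that by (auto simp: partition_on_def)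
  have minor: "laplacian_minor w V = (\<Sum>g\<in>forests V {r}. \<Prod>i\<in>V - {r}. w i (g i))"
    if "V \<in> P" "r \<in> V" for V r
    using that sym finV by (intro laplacian_minor_forests) auto
  have minor0: "0 \<le> laplacian_minor w V" if V: "V \<in> P" for V
  proof -
    obtain r where "r \<in> V" using neV[OF V] by blast
    then show ?thesis using minor[OF V] w by (auto intro!: sum_nonneg prod_nonneg)
  qed
  show ?thesis
  proof (cases "\<forall>V\<in>P. T \<inter> V \<noteq> {}")
    case True
    have "(\<Sum>h\<in>forests V T. \<Prod>i\<in>V - T. w i (h i)) \<le>
        b ^ (card (T \<inter> V) - 1) * laplacian_minor w V" if V: "V \<in> P" for V
    proof -
      obtain r where r: "r \<in> T" "r \<in> V" using True V by blast
      show ?thesis unfolding minor[OF V r(2)]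
        by (rule forests_merge_roots[OF finV[OF V] r w b]) (rule within[OF V _ r(2)])
    qed
    then have "(\<Prod>V\<in>P. \<Sum>h\<in>forests V T. \<Prod>i\<in>V - T. w i (h i)) \<le>
        (\<Prod>V\<in>P. b ^ (card (T \<inter> V) - 1) * laplacian_minor w V)"
      using w by (intro prod_mono) (auto intro!: sum_nonneg prod_nonneg)
    also have "\<dots> = b ^ (card T - card P) * (\<Prod>V\<in>P. laplacian_minor w V)"
      using card_partition_meet(2)[OF P fin T] True by (simp add: prod.distrib power_sum[symmetric])
    finally show ?thesis unfolding prod_forests_blocks[OF P fin] .
  next
    case False
    then obtain V where "V \<in> P" "T \<inter> V = {}" by blast
    then have "forests V T = {}" using forests_meet_roots[of _ V T] neV by blast
    then have "(\<Prod>V\<in>P. \<Sum>h\<in>forests V T. \<Prod>i\<in>V - T. w i (h i)) = 0"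
      using finP \<open>V \<in> P\<close> by (intro prod_zero bexI[of _ V]) auto
    then show ?thesis unfolding prod_forests_blocks[OF P fin]
      using b minor0 by (auto intro!: mult_nonneg_nonneg prod_nonneg)
  qed
qed

text \<open>With every vertex a root only the empty forest remains, whose weight is the empty
  product 1. The preceding bound thus puts a positive multiple of the product above 1.\<close>

lemma prod_laplacian_minor_pos:
  fixes w :: "nat \<Rightarrow> nat \<Rightarrow> real"
  assumes P: "partition_on N P" and fin: "finite N"
    and w: "\<And>i j. 0 \<le> w i j" and sym: "\<And>i j. w i j = w j i" and b: "0 \<le> b"
    and within: "\<And>V i j. V \<in> P \<Longrightarrow> i \<in> V \<Longrightarrow> j \<in> V \<Longrightarrow> i \<noteq> j \<Longrightarrow> 1 \<le> b * w i j"
  shows "0 < (\<Prod>V\<in>P. laplacian_minor w V)"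
proof -
  have "block_forests N P N = {\<lambda>_. undefined}"
    using P by (auto simp: block_forests_def forests_def partition_on_def)
  then have "1 \<le> b ^ (card N - card P) * (\<Prod>V\<in>P. laplacian_minor w V)"
    using forests_blocks_bound[OF P fin order_refl w sym b within] by simp
  then show ?thesis
    using b by (smt (verit) mult_nonneg_nonpos zero_le_power)
qed

section \<open>Cutting a forest along the oracle blocks\<close>

text \<open>A pair \<open>(S, B)\<close> records the roots \<open>S\<close> of a forest and the set \<open>B\<close> of vertices whose
  outgoing edge leaves its oracle block; cutting these edges yields a forest within the oracle
  blocks with root set \<open>S \<union> B\<close>.\<close>

definition cut_pairs :: "nat set \<Rightarrow> nat \<Rightarrow> (nat set \<times> nat set) set" where
  "cut_pairs N K = {(S, B). S \<subseteq> N \<and> B \<subseteq> N \<and> S \<inter> B = {} \<and> K \<le> card S + card B \<and>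
     \<not> (card S = K \<and> B = {})}"

lemma finite_cut_pairs [simp]: "finite N \<Longrightarrow> finite (cut_pairs N K)"
  by (rule finite_subset[of _ "Pow N \<times> Pow N"]) (auto simp: cut_pairs_def)

text \<open>Recording roots, cut vertices and lost targets makes the cut reversible. Each lost edge
  weighs at most \<open>a\<close> wherever it pointed, so its target contributes only
  \<open>card N\<close> choices. \<open>c\<close> stands for the factors that depend on the number
  of blocks, which is the number of roots.\<close>

lemma other_partitions_bound:
  fixes w :: "nat \<Rightarrow> nat \<Rightarrow> real" and c :: "nat \<Rightarrow> real"
  assumes P0: "partition_on N P0" and fin: "finite N"
    and w: "\<And>i j. 0 \<le> w i j" and sym: "\<And>i j. w i j = w j i" and b: "0 \<le> b" and a: "0 \<le> a"
    and within: "\<And>V i j. V \<in> P0 \<Longrightarrow> i \<in> V \<Longrightarrow> j \<in> V \<Longrightarrow> i \<noteq> j \<Longrightarrow> 1 \<le> b * w i j"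
    and between: "\<And>V i j. V \<in> P0 \<Longrightarrow> i \<in> V \<Longrightarrow> j \<in> N - V \<Longrightarrow> w i j \<le> a"
    and c: "\<And>k. 0 \<le> c k"
  shows "(\<Sum>P\<in>{P. partition_on N P} - {P0}. c (card P) * (\<Prod>V\<in>P. laplacian_minor w V)) \<le>
    (\<Sum>(S, B)\<in>cut_pairs N (card P0). c (card S) * (a * card N) ^ card B * b ^ (card S + card B - card P0)) *
    (\<Prod>V\<in>P0. laplacian_minor w V)"
proof -
  define PP where "PP = {P. partition_on N P} - {P0}"
  \<comment> \<open>One canonical root per block, so that each spanning tree of a block is counted
    once.\<close>
  define R where "R P = Min ` P" for P :: "nat set set"
  define W where "W T g = (\<Prod>i\<in>N - T. w i (g i))" for T and g :: "nat \<Rightarrow> nat"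
  define bad where "bad S g = {i \<in> N - S. \<not> (\<exists>V\<in>P0. i \<in> V \<and> g i \<in> V)}" for S and g :: "nat \<Rightarrow> nat"
  define X where "X = (SIGMA P:PP. block_forests N P (R P))"
  define Y where "Y = (SIGMA SB:cut_pairs N (card P0).
      block_forests N P0 (fst SB \<union> snd SB) \<times> (snd SB \<rightarrow>\<^sub>E N))"
  define f where "f = (\<lambda>(P, g). c (card P) * W (R P) g)"
  define F where "F = (\<lambda>(SB, h, u :: nat \<Rightarrow> nat). c (card (fst SB)) * a ^ card (snd SB) * W (fst SB \<union> snd SB) h)"
  define \<phi> where "\<phi> = (\<lambda>(P, g). ((R P, bad (R P) g),
      (restrict g (N - (R P \<union> bad (R P) g)), restrict g (bad (R P) g))))"
  have W0: "0 \<le> W T g" for T g using w by (auto simp: W_def intro: prod_nonneg)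
  have finPP: "finite PP" using finitely_many_partition_on[OF fin] by (simp add: PP_def)
  have part: "partition_on N P" if "P \<in> PP" for P using that by (simp add: PP_def)
  have fin_blk: "finite V" "V \<noteq> {}" "V \<subseteq> N" if "partition_on N P" "V \<in> P" for P V
    using that fin by (auto simp: partition_on_def intro: finite_subset)
  have MinV: "Min V \<in> V" if "partition_on N P" "V \<in> P" for P V
    using fin_blk[OF that] by simp
  have uniq: "V = V'" if "partition_on N P" "V \<in> P" "V' \<in> P" "i \<in> V" "i \<in> V'" for P V V' and i :: nat
    using that by (auto simp: partition_on_def disjoint_def)
  have RV: "R P \<inter> V = {Min V}" if P: "partition_on N P" and V: "V \<in> P" for P V
  proof
    show "{Min V} \<subseteq> R P \<inter> V" using MinV[OF P V] V by (auto simp: R_def)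
    show "R P \<inter> V \<subseteq> {Min V}"
    proof
      fix x assume x: "x \<in> R P \<inter> V"
      then obtain V' where V': "V' \<in> P" "x = Min V'" by (auto simp: R_def)
      have "V' = V" using uniq[OF P V'(1) V, of x] MinV[OF P V'(1)] V'(2) x by blast
      then show "x \<in> {Min V}" using V' by simp
    qed
  qed
  have one_root: "\<exists>s. R P \<inter> V = {s}" if "partition_on N P" "V \<in> P" for P V
    using RV[OF that] by blast
  have Rsub: "R P \<subseteq> N" if "partition_on N P" for P
    using MinV[OF that] fin_blk(3)[OF that] by (auto simp: R_def)
  have cardR: "card (R P) = card P" if "partition_on N P" for P
    unfolding R_def
  proof (rule card_image, rule inj_onI)
    fix V V' assume "V \<in> P" "V' \<in> P" "Min V = Min V'"
    then show "V = V'" using uniq[OF that, of V V' "Min V"] MinV[OF that] by metis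
  qed
  have X_eq: "(\<Sum>P\<in>PP. c (card P) * (\<Prod>V\<in>P. laplacian_minor w V)) = sum f X"
  proof -
    have "(\<Prod>V\<in>P. laplacian_minor w V) = (\<Sum>g\<in>block_forests N P (R P). W (R P) g)" if P: "P \<in> PP" for P
    proof -
      have "laplacian_minor w V = (\<Sum>g\<in>forests V (R P). \<Prod>i\<in>V - R P. w i (g i))" if V: "V \<in> P" for V
      proof -
        have V_R: "V - R P = V - {Min V}" using RV[OF part[OF P] V] by blast
        then have "forests V (R P) = forests V {Min V}" by (rule forests_cong)
        then show ?thesis unfolding V_R
          using laplacian_minor_forests[OF sym fin_blk(1)[OF part[OF P] V] MinV[OF part[OF P] V]] by simp
      qed
      then have "(\<Prod>V\<in>P. laplacian_minor w V) = (\<Prod>V\<in>P. \<Sum>g\<in>forests V (R P). \<Prod>i\<in>V - R P. w i (g i))"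
        by simp
      then show ?thesis unfolding prod_forests_blocks[OF part[OF P] fin] W_def .
    qed
    then have "(\<Sum>P\<in>PP. c (card P) * (\<Prod>V\<in>P. laplacian_minor w V)) =
        (\<Sum>P\<in>PP. \<Sum>g\<in>block_forests N P (R P). c (card P) * W (R P) g)"
      by (simp add: sum_distrib_left)
    also have "\<dots> = sum f X" unfolding X_def f_def
      by (rule sum.Sigma) (use finPP fin in auto)
    finally show ?thesis .
  qed
  have X_props: "partition_on N P" "P \<noteq> P0" "g \<in> block_forests N P (R P)"
      "g \<in> (N - R P) \<rightarrow>\<^sub>E N" "bad (R P) g \<subseteq> N" "R P \<inter> bad (R P) g = {}"
    if "(P, g) \<in> X" for P g
    using that by (auto simp: X_def PP_def block_forests_def forests_def bad_def)
  have cut: "restrict g (N - (R P \<union> bad (R P) g)) \<in> block_forests N P0 (R P \<union> bad (R P) g)"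
    if "(P, g) \<in> X" for P g
  proof -
    have gf: "g \<in> forests N (R P)" using X_props(3)[OF that] by (simp add: block_forests_def)
    obtain d :: "nat \<Rightarrow> nat" where d: "\<And>i. i \<in> N \<Longrightarrow> i \<notin> R P \<Longrightarrow> d (g i) < d i"
      using forestsE[OF gf] by blast
    have "restrict g (N - (R P \<union> bad (R P) g)) \<in> forests N (R P \<union> bad (R P) g)"
      by (rule forestsI[where d = d]) (use X_props(4)[OF that] d in auto)
    moreover have "g i \<in> V" if V: "V \<in> P0" "i \<in> V" and i: "i \<notin> R P" "i \<notin> bad (R P) g" for V i
    proof -
      have "i \<in> N" using V fin_blk(3)[OF P0] by blast
      then obtain V' where "V' \<in> P0" "i \<in> V'" "g i \<in> V'" using i by (auto simp: bad_def)
      then show ?thesis using uniq[OF P0 _ V(1), of V' i] V(2) by blast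
    qed
    ultimately show ?thesis using fin_blk(3)[OF P0] by (auto simp: block_forests_def)
  qed
  have cut_pair: "(R P, bad (R P) g) \<in> cut_pairs N (card P0)" if Pg: "(P, g) \<in> X" for P g
  proof -
    let ?B = "bad (R P) g"
    have finRB: "finite (R P)" "finite ?B" using Rsub[OF X_props(1)[OF Pg]] X_props(5)[OF Pg] fin
      by (auto intro: finite_subset)
    have T: "R P \<union> ?B \<subseteq> N" using Rsub[OF X_props(1)[OF Pg]] X_props(5)[OF Pg] by blast
    \<comment> \<open>The cut forest restricts to a forest on each oracle block, and such a forest
      has a root.\<close>
    have meet: "(R P \<union> ?B) \<inter> V \<noteq> {}" if "V \<in> P0" for V
      by (rule forests_meet_roots[OF block_forests_restrict[OF P0 cut[OF Pg] that]])
        (use fin_blk(2)[OF P0 that] in auto)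
    have "card P0 \<le> card (R P \<union> ?B)" by (rule card_partition_meet(1)[OF P0 fin T meet])
    also have "\<dots> = card (R P) + card ?B"
      using finRB X_props(6)[OF Pg] by (rule card_Un_disjoint)
    finally have le: "card P0 \<le> card (R P) + card ?B" .
    \<comment> \<open>With no cut edge and \<open>card P0\<close> roots, \<open>g\<close> would be a
      forest inside the oracle blocks with one root in each, and a forest determines its
      partition.\<close>
    have "\<not> (card (R P) = card P0 \<and> ?B = {})"
    proof
      assume *: "card (R P) = card P0 \<and> ?B = {}"
      have one: "\<exists>s. R P \<inter> V = {s}" if "V \<in> P0" for V
        using card_partition_meet(3)[OF P0 fin T meet] * that by (simp add: card_1_singleton_iff)
      have "restrict g (N - R P) = g" using X_props(4)[OF Pg]
        by (auto simp: restrict_def PiE_iff extensional_def)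
      then have "g \<in> block_forests N P0 (R P)" using cut[OF Pg] * by simp
      then have "P = P0"
        using block_forests_determine_partition[OF X_props(1)[OF Pg] P0 X_props(3)[OF Pg] _ _ one]
          one_root[OF X_props(1)[OF Pg]] by blast
      then show False using X_props(2)[OF Pg] by simp
    qed
    then show ?thesis using T le X_props(6)[OF Pg] by (auto simp: cut_pairs_def)
  qed
  have finSB: "finite S" "finite B" if "(S, B) \<in> cut_pairs N (card P0)" for S B
    using that finite_subset[OF _ fin] by (auto simp: cut_pairs_def)
  have "sum f X \<le> sum F Y"
  proof (rule sum_le_inj_on[where \<phi> = \<phi>])
    show "finite Y" unfolding Y_def using fin finSB
      by (intro finite_SigmaI finite_cartesian_product finite_PiE) auto
    show "inj_on \<phi> X"
    \<comment> \<open>The two restrictions and the root set rebuild \<open>g\<close>; then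
      \<open>g\<close> and its roots rebuild the partition.\<close>
    proof (rule inj_onI, clarify)
      fix P g P' g' assume *: "(P, g) \<in> X" "(P', g') \<in> X" "\<phi> (P, g) = \<phi> (P', g')"
      define B where "B = bad (R P) g"
      have R_eq: "R P' = R P" and B': "bad (R P') g' = B"
        and r1: "restrict g (N - (R P \<union> B)) = restrict g' (N - (R P \<union> B))"
        and r2: "restrict g B = restrict g' B"
        using *(3) unfolding \<phi>_def B_def by auto
      have "g i = g' i" for i
      proof (cases "i \<in> N - R P")
        case True
        then show ?thesis using fun_cong[OF r1, of i] fun_cong[OF r2, of i] by (cases "i \<in> B") auto
      next
        case False
        then show ?thesis using X_props(4)[OF *(1)] X_props(4)[OF *(2)] R_eq
          by (auto simp: PiE_iff extensional_def)
      qed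
      then have g: "g = g'" by blast
      moreover have "P = P'"
      proof (rule block_forests_determine_partition[OF X_props(1)[OF *(1)] X_props(1)[OF *(2)]])
        show "g \<in> block_forests N P (R P)" by (rule X_props(3)[OF *(1)])
        show "g \<in> block_forests N P' (R P)" using X_props(3)[OF *(2)] g R_eq by simp
        show "\<exists>s. R P \<inter> V = {s}" if "V \<in> P" for V by (rule one_root[OF X_props(1)[OF *(1)] that])
        show "\<exists>s. R P \<inter> V = {s}" if "V \<in> P'" for V
          using one_root[OF X_props(1)[OF *(2)] that] R_eq by simp
      qed
      ultimately show "P = P' \<and> g = g'" by blast
    qed
    show "\<phi> ` X \<subseteq> Y"
    proof (rule image_subsetI)
      fix x assume "x \<in> X"
      obtain P g where x: "x = (P, g)" by (cases x)
      have Pg: "(P, g) \<in> X" using \<open>x \<in> X\<close> x by simp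
      have "restrict g (bad (R P) g) \<in> bad (R P) g \<rightarrow>\<^sub>E N"
        using X_props(4)[OF Pg] by (auto simp: bad_def)
      then show "\<phi> x \<in> Y" using cut_pair[OF Pg] cut[OF Pg] by (simp add: \<phi>_def Y_def x)
    qed
    show "f x \<le> F (\<phi> x)" if "x \<in> X" for x
    proof -
      obtain P g where x: "x = (P, g)" by (cases x)
      have Pg: "(P, g) \<in> X" using that x by simp
      define B where "B = bad (R P) g"
      have BN: "B \<subseteq> N" "R P \<inter> B = {}" using X_props(5,6)[OF Pg] by (auto simp: B_def)
      have "N - R P = (N - (R P \<union> B)) \<union> B" using BN by blast
      then have "W (R P) g = (\<Prod>i\<in>(N - (R P \<union> B)) \<union> B. w i (g i))" by (simp add: W_def)
      also have "\<dots> = W (R P \<union> B) g * (\<Prod>i\<in>B. w i (g i))"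
        unfolding W_def using fin BN by (intro prod.union_disjoint) (auto intro: finite_subset)
      also have "(\<Prod>i\<in>B. w i (g i)) \<le> (\<Prod>i\<in>B. a)"
      proof (rule prod_mono, intro conjI w)
        fix i assume i: "i \<in> B"
        then have "i \<in> N" "g i \<in> N" using BN X_props(4)[OF Pg] by (auto simp: B_def bad_def)
        moreover from this obtain V where "V \<in> P0" "i \<in> V" using P0 by (auto simp: partition_on_def)
        ultimately show "w i (g i) \<le> a" using between[of V i "g i"] i by (auto simp: B_def bad_def)
      qed
      finally have "W (R P) g \<le> W (R P \<union> B) g * a ^ card B"
        using W0 by (auto simp: mult_left_mono)
      also have "W (R P \<union> B) g = W (R P \<union> B) (restrict g (N - (R P \<union> B)))"
        unfolding W_def by (intro prod.cong) auto
      finally have "c (card (R P)) * W (R P) g \<le>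
          c (card (R P)) * (W (R P \<union> B) (restrict g (N - (R P \<union> B))) * a ^ card B)"
        using c by (intro mult_left_mono) auto
      then show ?thesis
        using cardR[OF X_props(1)[OF Pg]] by (simp add: x f_def F_def \<phi>_def B_def mult_ac)
    qed
    show "0 \<le> F y" if "y \<in> Y" for y
      using W0 a c by (auto simp: F_def split: prod.splits)
  qed
  also have "sum F Y = (\<Sum>SB\<in>cut_pairs N (card P0).
      \<Sum>(h, u)\<in>block_forests N P0 (fst SB \<union> snd SB) \<times> (snd SB \<rightarrow>\<^sub>E N).
        c (card (fst SB)) * a ^ card (snd SB) * W (fst SB \<union> snd SB) h)"
    unfolding Y_def F_def using fin
    by (subst sum.Sigma) (auto intro!: finite_cartesian_product finite_PiE simp: finSB case_prod_unfold)
  also have "\<dots> \<le> (\<Sum>(S, B)\<in>cut_pairs N (card P0).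
      c (card S) * (a * card N) ^ card B * b ^ (card S + card B - card P0) * (\<Prod>V\<in>P0. laplacian_minor w V))"
  proof (rule sum_mono, clarify)
    fix S B assume "(S, B) \<in> cut_pairs N (card P0)"
    then have SB: "S \<subseteq> N" "B \<subseteq> N" "S \<inter> B = {}" by (auto simp: cut_pairs_def)
    have fins: "finite S" "finite B" using SB finite_subset[OF _ fin] by auto
    have "(\<Sum>(h, u)\<in>block_forests N P0 (fst (S, B) \<union> snd (S, B)) \<times> (snd (S, B) \<rightarrow>\<^sub>E N).
        c (card (fst (S, B))) * a ^ card (snd (S, B)) * W (fst (S, B) \<union> snd (S, B)) h) =
        (\<Sum>h\<in>block_forests N P0 (S \<union> B). \<Sum>u\<in>B \<rightarrow>\<^sub>E N. c (card S) * a ^ card B * W (S \<union> B) h)"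
      by (simp add: sum.cartesian_product del: sum_constant)
    \<comment> \<open>\<open>u\<close> does not occur in the weight, so summing over it only counts
      functions: \<open>card N ^ card B\<close>.\<close>
    also have "\<dots> = c (card S) * (a * card N) ^ card B * (\<Sum>h\<in>block_forests N P0 (S \<union> B). W (S \<union> B) h)"
      using fins by (simp add: card_PiE power_mult_distrib sum_distrib_left mult_ac)
    also have "(\<Sum>h\<in>block_forests N P0 (S \<union> B). W (S \<union> B) h) \<le>
        b ^ (card (S \<union> B) - card P0) * (\<Prod>V\<in>P0. laplacian_minor w V)"
      unfolding W_def by (rule forests_blocks_bound[OF P0 fin _ w sym b within]) (use SB in auto)
    also have "card (S \<union> B) = card S + card B" using fins SB(3) by (rule card_Un_disjoint)
    finally show "(\<Sum>(h, u)\<in>block_forests N P0 (fst (S, B) \<union> snd (S, B)) \<times> (snd (S, B) \<rightarrow>\<^sub>E N).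
        c (card (fst (S, B))) * a ^ card (snd (S, B)) * W (fst (S, B) \<union> snd (S, B)) h) \<le>
        c (card S) * (a * card N) ^ card B * b ^ (card S + card B - card P0) * (\<Prod>V\<in>P0. laplacian_minor w V)"
      using c a by (auto simp: mult_left_mono mult.assoc)
  qed
  finally show ?thesis
    unfolding X_eq[symmetric] PP_def[symmetric] by (simp add: sum_distrib_right case_prod_unfold)
qed

section \<open>Posterior odds against the oracle partition\<close>

text \<open>Expanding the product of \<open>1 + 1/n\<close> over the elements of \<open>N\<close>
  gives one term per subset.\<close>

lemma sum_Pow_inverse_card_le:
  assumes "finite N" "N \<noteq> {}"
  shows "(\<Sum>S\<in>Pow N. (1 / real (card N)) ^ card S) \<le> exp 1"
proof -
  have n: "card N > 0" using assms by (simp add: card_gt_0_iff)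
  have "(\<Sum>S\<in>Pow N. (1 / real (card N)) ^ card S) = (\<Prod>i\<in>N. 1 / real (card N) + 1)"
    using assms(1) by (subst prod_add) simp_all
  also have "\<dots> = (1 + 1 / real (card N)) ^ card N" by (simp add: add.commute)
  also have "\<dots> \<le> exp 1"
    using exp_ge_one_plus_x_over_n_power_n[of "card N" 1] n by simp
  finally show ?thesis .
qed

text \<open>Compares the orderings of a competitor with those of the oracle: each factor beyond
  \<open>fact K\<close> is at most \<open>n\<close>, and there are at most \<open>e\<close> of
  them.\<close>

lemma fact_le_fact_mult_power:
  assumes "k \<le> n" "k \<le> K + e" "1 \<le> n"
  shows "(fact k :: real) \<le> fact K * real n ^ e"
proof (cases "k \<le> K")
  case True
  have "(fact k :: real) \<le> fact K" using True by (rule fact_mono)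
  also have "\<dots> \<le> fact K * real n ^ e" using assms by simp
  finally show ?thesis .
next
  case False
  have "(fact (K + d) :: real) \<le> fact K * real n ^ d" if "K + d \<le> n" for d
    using that
  proof (induction d)
    case (Suc d)
    have "(fact (K + Suc d) :: real) = real (K + Suc d) * fact (K + d)" by simp
    also have "\<dots> \<le> real n * (fact K * real n ^ d)"
      using Suc by (intro mult_mono) auto
    finally show ?case by (simp add: mult_ac)
  qed simp
  from this[of "k - K"] have "(fact k :: real) \<le> fact K * real n ^ (k - K)"
    using False assms by simp
  also have "\<dots> \<le> fact K * real n ^ e"
    using assms by (intro mult_left_mono power_increasing) auto
  finally show ?thesis .
qed

text \<open>Each term is at most a common constant times \<open>(1/n) ^ (card S + card B)\<close>,
  and these powers sum to at most \<open>exp 2\<close> over all pairs of subsets.\<close>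

lemma cut_pairs_sum_bound:
  fixes a b C :: real
  assumes fin: "finite N" and n: "n = card N" "1 \<le> n" and C: "1 \<le> C" and ab: "0 \<le> a" "0 \<le> b"
    and x: "real n ^ 3 * C * b \<le> 1" and z: "real n ^ 2 * a \<le> 1"
  shows "(\<Sum>(S, B)\<in>cut_pairs N K.
      fact (card S) * (C * n) ^ card S * (a * n) ^ card B * b ^ (card S + card B - K)) \<le>
    exp 2 * (fact K * (real n ^ 2 * C) ^ K * (real n ^ 3 * C * b + real n ^ 2 * a))"
proof -
  \<comment> \<open>\<open>x'\<close> collects the cost of one surplus root: \<open>b\<close> for
    merging it, \<open>n^2 * C\<close> for the root itself, \<open>n\<close> for the factorial.
    \<open>z'\<close> is the cost of one cut edge.\<close>
  define x' where "x' = real n ^ 3 * C * b"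
  define z' where "z' = real n ^ 2 * a"
  define H where "H = fact K * (real n ^ 2 * C) ^ K * (x' + z')"
  have x': "0 \<le> x'" "x' \<le> 1" and z': "0 \<le> z'" "z' \<le> 1"
    using x z ab C by (auto simp: x'_def z'_def)
  have n1: "1 \<le> real n" using n by simp
  have H0: "0 \<le> H" using x' z' C by (simp add: H_def)
  have term_le: "fact (card S) * (C * n) ^ card S * (a * n) ^ card B * b ^ (card S + card B - K) \<le>
      H * ((1 / real n) ^ card S * (1 / real n) ^ card B)" if "(S, B) \<in> cut_pairs N K" for S B
  proof -
    define k where "k = card S"
    define j where "j = card B"
    define e where "e = k + j - K"
    have SB: "S \<subseteq> N" "B \<subseteq> N" "K \<le> k + j" "\<not> (k = K \<and> B = {})"
      using that by (auto simp: cut_pairs_def k_def j_def)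
    have "finite B" using SB fin finite_subset by blast
    then have nz: "\<not> (e = 0 \<and> j = 0)" using SB by (auto simp: e_def j_def)
    have kn: "k \<le> n" using SB card_mono[OF fin] by (simp add: k_def n)
    have ke: "k \<le> K + e" using SB by (simp add: e_def)
    \<comment> \<open>Both numbers are at most 1 and one exponent is positive, so the product is at
      most one of the two.\<close>
    have xz: "x' ^ e * z' ^ j \<le> x' + z'"
    proof (cases "e = 0")
      case True
      then have "z' ^ j \<le> z' ^ 1" using nz z' by (intro power_decreasing) auto
      then show ?thesis using True x' by simp
    next
      case False
      then have "x' ^ e \<le> x' ^ 1" using x' by (intro power_decreasing) auto
      then have "x' ^ e * z' ^ j \<le> x' * 1"
        using x' z' by (intro mult_mono) (auto intro: power_le_one)
      then show ?thesis using z' by simp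
    qed
    have "1 * 1 \<le> real n ^ 2 * C" using n1 C by (intro mult_mono) auto
    then have P: "(real n ^ 2 * C) ^ k \<le> (real n ^ 2 * C) ^ (K + e)"
      using ke by (intro power_increasing) auto
    have "fact k * (C * n) ^ k * (a * n) ^ j * b ^ e * (real n ^ k * real n ^ j) =
        fact k * (real n ^ 2 * C) ^ k * b ^ e * z' ^ j"
      by (simp add: z'_def power_mult_distrib power2_eq_square mult_ac)
    \<comment> \<open>Raising the exponent from \<open>k\<close> to \<open>K + e\<close> separates
      the fixed power \<open>K\<close> from the part absorbed into \<open>x' ^ e\<close>.\<close>
    also have "\<dots> \<le> (fact K * real n ^ e) * (real n ^ 2 * C) ^ (K + e) * b ^ e * z' ^ j"
      using fact_le_fact_mult_power[OF kn ke n(2)] P ab C z' by (intro mult_mono) auto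
    also have "\<dots> = fact K * (real n ^ 2 * C) ^ K * (x' ^ e * z' ^ j)"
      by (simp add: x'_def power_add power_mult_distrib power2_eq_square power3_eq_cube mult_ac)
    also have "\<dots> \<le> H" unfolding H_def using xz C by (intro mult_left_mono) auto
    finally have "fact k * (C * n) ^ k * (a * n) ^ j * b ^ e * (real n ^ k * real n ^ j) \<le> H" .
    then have "fact k * (C * n) ^ k * (a * n) ^ j * b ^ e \<le> H / (real n ^ k * real n ^ j)"
      using n1 by (simp add: pos_le_divide_eq)
    then show ?thesis by (simp add: k_def j_def e_def power_one_over divide_simps)
  qed
  have Pow_nonneg: "0 \<le> (\<Sum>S\<in>Pow N. (1 / real n) ^ card S)" by (auto intro: sum_nonneg)
  have "N \<noteq> {}" using n by auto
  note Pow_le = sum_Pow_inverse_card_le[OF fin this, folded n(1)]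
  have "(\<Sum>(S, B)\<in>cut_pairs N K.
      fact (card S) * (C * n) ^ card S * (a * n) ^ card B * b ^ (card S + card B - K)) \<le>
      (\<Sum>(S, B)\<in>cut_pairs N K. H * ((1 / real n) ^ card S * (1 / real n) ^ card B))"
    by (rule sum_mono) (use term_le in auto)
  also have "\<dots> \<le> (\<Sum>(S, B)\<in>Pow N \<times> Pow N. H * ((1 / real n) ^ card S * (1 / real n) ^ card B))"
    using fin H0 by (intro sum_mono2) (auto simp: cut_pairs_def)
  also have "\<dots> = H * ((\<Sum>S\<in>Pow N. (1 / real n) ^ card S) * (\<Sum>B\<in>Pow N. (1 / real n) ^ card B))"
    unfolding sum_product by (simp only: sum.cartesian_product sum_distrib_left case_prod_unfold)
  also have "\<dots> \<le> H * (exp 1 * exp 1)"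
    using H0 Pow_le Pow_nonneg by (intro mult_left_mono mult_mono) auto
  also have "exp 1 * exp 1 = (exp 2 :: real)" by (simp flip: exp_add)
  finally show ?thesis by (simp add: H_def x'_def z'_def mult.commute)
qed

text \<open>The unnormalised posterior mass of a whole relabelling class; the factorial counts its
  orderings.\<close>

definition class_weight ::
  "real \<Rightarrow> ('a \<Rightarrow> real) \<Rightarrow> ('a \<Rightarrow> 'a \<Rightarrow> real) \<Rightarrow> (nat \<Rightarrow> 'a) \<Rightarrow> nat set set \<Rightarrow> real" where
  "class_weight lam r f y P =
     fact (card P) * (\<Prod>V\<in>P. lam * (\<Sum>i\<in>V. r (y i)) * laplacian_minor (edge_weight f y) V)"

lemma ordered_partitions_eq:
  "ordered_partitions n = (\<Union>P\<in>{P. partition_on {1..n} P}. permutations_of_set P)"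
  by (auto simp: ordered_partitions_def permutations_of_set_def)

lemma sum_bsf_weight:
  "(\<Sum>Vs\<in>ordered_partitions n. bsf_weight lam r f y Vs) =
    (\<Sum>P\<in>{P. partition_on {1..n} P}. class_weight lam r f y P)"
proof -
  have fin: "finite {P. partition_on {1..n} P}" by (rule finitely_many_partition_on) simp
  have finP: "finite P" if "partition_on {1..n} P" for P
    using finite_elements[OF _ that] by simp
  have "(\<Sum>Vs\<in>ordered_partitions n. bsf_weight lam r f y Vs) =
      (\<Sum>P\<in>{P. partition_on {1..n} P}. \<Sum>Vs\<in>permutations_of_set P. bsf_weight lam r f y Vs)"
    unfolding ordered_partitions_eq using fin
    by (intro sum.UNION_disjoint) (auto dest: permutations_of_setD)
  also have "\<dots> = (\<Sum>P\<in>{P. partition_on {1..n} P}. class_weight lam r f y P)"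
  proof (rule sum.cong[OF refl])
    fix P assume P: "P \<in> {P. partition_on {1..n} P}"
    have "bsf_weight lam r f y Vs =
        (\<Prod>V\<in>P. lam * (\<Sum>i\<in>V. r (y i)) * laplacian_minor (edge_weight f y) V)"
      if "Vs \<in> permutations_of_set P" for Vs
      using that by (auto simp: permutations_of_set_def bsf_weight_def prod.distinct_set_conv_list)
    then show "(\<Sum>Vs\<in>permutations_of_set P. bsf_weight lam r f y Vs) = class_weight lam r f y P"
      using finP P by (simp add: class_weight_def)
  qed
  finally show ?thesis .
qed

lemma post_equiv_eq_class_weight:
  assumes "Vs \<in> ordered_partitions n"
  shows "post_equiv n lam r f y Vs =
    class_weight lam r f y (set Vs) / (\<Sum>P\<in>{P. partition_on {1..n} P}. class_weight lam r f y P)"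
proof -
  have "distinct Vs" using assms by (simp add: ordered_partitions_def)
  then have "bsf_weight lam r f y Vs =
      (\<Prod>V\<in>set Vs. lam * (\<Sum>i\<in>V. r (y i)) * laplacian_minor (edge_weight f y) V)"
    and "card (set Vs) = length Vs"
    by (simp_all add: bsf_weight_def prod.distinct_set_conv_list distinct_card)
  then have "fact (length Vs) * bsf_weight lam r f y Vs = class_weight lam r f y (set Vs)"
    by (simp add: class_weight_def)
  then show ?thesis
    by (simp add: post_equiv_def post_ordered_def bsf_const_def sum_bsf_weight)
qed

lemma laplacian_minor_nonneg:
  assumes "\<And>i j. 0 \<le> w i j" "\<And>i j. w i j = w j i" "finite V" "V \<noteq> {}"
  shows "0 \<le> laplacian_minor w V"
proof -
  obtain r where "r \<in> V" using assms by blast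
  then show ?thesis using laplacian_minor_forests[of w V r] assms
    by (auto intro!: sum_nonneg prod_nonneg)
qed

text \<open>A spanning tree of \<open>V\<close> has \<open>card V - 1\<close> edges, and the factor
  \<open>q\<close> on the left supplies the missing power. Over the blocks of any partition these
  powers multiply to the same \<open>q ^ n\<close>, which makes \<open>del * lam\<close> the natural
  unit of edge weight.\<close>

lemma laplacian_minor_scale:
  fixes w :: "nat \<Rightarrow> nat \<Rightarrow> real"
  assumes sym: "\<And>i j. w i j = w j i" and V: "finite V" "V \<noteq> {}" and q: "q \<noteq> 0"
  shows "q * laplacian_minor w V = q ^ card V * laplacian_minor (\<lambda>i j. w i j / q) V"
proof -
  obtain r where r: "r \<in> V" using V by blast
  have card: "card V = Suc (card (V - {r}))" by (rule card.remove[OF V(1) r])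
  have "laplacian_minor (\<lambda>i j. w i j / q) V =
      (\<Sum>g\<in>forests V {r}. (\<Prod>i\<in>V - {r}. w i (g i)) / q ^ card (V - {r}))"
    using laplacian_minor_forests[of "\<lambda>i j. w i j / q" V r] V r sym by (simp add: prod_dividef)
  then show ?thesis
    unfolding card using laplacian_minor_forests[of w V r] V r sym q
    by (simp add: sum_divide_distrib[symmetric])
qed

text \<open>The common factor \<open>q ^ n\<close> cancels. In units of \<open>del\<close>, root
  sums are at most \<open>C * n\<close> for competitors and at least \<open>C1\<close> for the
  oracle; with the \<open>n\<close> spent on summing over root sets this gives the base
  \<open>n^2 * C / C1\<close>.\<close>

lemma class_weight_ratio:
  fixes a b :: real
  assumes n: "1 \<le> n" and P0: "partition_on {1..n} P0"
    and f0: "\<And>u v. 0 \<le> f u v" and fsym: "\<And>u v. f u v = f v u"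
    and lam: "0 < lam" and del: "0 < del" and C1: "0 < C1" and C: "1 \<le> C"
    and r: "\<And>i. i \<in> {1..n} \<Longrightarrow> C1 * del \<le> r (y i)" "\<And>i. i \<in> {1..n} \<Longrightarrow> r (y i) \<le> C * del"
    and ab: "0 \<le> a" "0 \<le> b"
    and within: "\<And>V i j. V \<in> P0 \<Longrightarrow> i \<in> V \<Longrightarrow> j \<in> V \<Longrightarrow> i \<noteq> j \<Longrightarrow> del * lam \<le> b * edge_weight f y i j"
    and between: "\<And>V i j. V \<in> P0 \<Longrightarrow> i \<in> V \<Longrightarrow> j \<in> {1..n} - V \<Longrightarrow> edge_weight f y i j \<le> a * (del * lam)"
    and x: "real n ^ 3 * C * b \<le> 1" and z: "real n ^ 2 * a \<le> 1"
  shows "(\<Sum>P\<in>{P. partition_on {1..n} P} - {P0}. class_weight lam r f y P) \<le>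
      exp 2 * (real n ^ 2 * C / C1) ^ card P0 * (real n ^ 3 * C * b + real n ^ 2 * a) *
      class_weight lam r f y P0" (is "?lhs \<le> _")
    and "0 < class_weight lam r f y P0"
proof -
  define q where "q = del * lam"
  define w where "w = (\<lambda>i j. edge_weight f y i j / q)"
  have q: "0 < q" using lam del by (simp add: q_def)
  have w0: "0 \<le> w i j" for i j using f0 q by (simp add: w_def edge_weight_def)
  have esym: "edge_weight f y i j = edge_weight f y j i" for i j
    using fsym by (simp add: edge_weight_def)
  have wsym: "w i j = w j i" for i j using esym[of i j] by (simp add: w_def)
  have C0: "0 \<le> C * real n" using C by simp
  have minor0: "0 \<le> laplacian_minor w V" if "finite V" "V \<noteq> {}" for V
    by (rule laplacian_minor_nonneg[OF w0 wsym that])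
  have blk: "finite V" "V \<noteq> {}" "V \<subseteq> {1..n}" if "partition_on {1..n} P" "V \<in> P" for P V
  proof -
    show "V \<noteq> {}" "V \<subseteq> {1..n}" using that by (auto simp: partition_on_def)
    then show "finite V" using finite_subset by blast
  qed
  have scaled: "(\<Prod>V\<in>P. lam * (\<Sum>i\<in>V. r (y i)) * laplacian_minor (edge_weight f y) V) =
      q ^ n * (\<Prod>V\<in>P. (\<Sum>i\<in>V. r (y i)) / del * laplacian_minor w V)" if P: "partition_on {1..n} P" for P
  proof -
    have "n = card (\<Union>P)" using P by (simp add: partition_on_def)
    also have "\<dots> = (\<Sum>V\<in>P. card V)"
      using P blk(1)[OF P] by (intro card_Union_disjoint) (auto simp: partition_on_def disjoint_def pairwise_def disjnt_def)
    finally have "q ^ n = (\<Prod>V\<in>P. q ^ card V)" by (simp add: power_sum)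
    moreover have "lam * (\<Sum>i\<in>V. r (y i)) * laplacian_minor (edge_weight f y) V =
        q ^ card V * ((\<Sum>i\<in>V. r (y i)) / del * laplacian_minor w V)" if "V \<in> P" for V
    proof -
      have "lam * (\<Sum>i\<in>V. r (y i)) * laplacian_minor (edge_weight f y) V =
          (\<Sum>i\<in>V. r (y i)) / del * (q * laplacian_minor (edge_weight f y) V)"
        using del by (simp add: q_def)
      also have "q * laplacian_minor (edge_weight f y) V = q ^ card V * laplacian_minor w V"
        unfolding w_def using q esym blk[OF P that] by (intro laplacian_minor_scale) auto
      finally show ?thesis by simp
    qed
    ultimately show ?thesis by (simp add: prod.distrib[symmetric])
  qed
  have upper: "class_weight lam r f y P \<le>
      q ^ n * (fact (card P) * (C * n) ^ card P * (\<Prod>V\<in>P. laplacian_minor w V))"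
    if P: "partition_on {1..n} P" for P
  proof -
    have "(\<Prod>V\<in>P. (\<Sum>i\<in>V. r (y i)) / del * laplacian_minor w V) \<le> (\<Prod>V\<in>P. (C * n) * laplacian_minor w V)"
    proof (rule prod_mono)
      fix V assume V: "V \<in> P"
      have "(\<Sum>i\<in>V. r (y i)) \<le> (\<Sum>i\<in>V. C * del)"
        by (rule sum_mono) (use r(2) blk(3)[OF P V] in auto)
      also have "\<dots> \<le> (C * n) * del"
        using card_mono[OF _ blk(3)[OF P V]] C del by (simp add: mult_right_mono mult_left_mono mult_ac)
      finally have up: "(\<Sum>i\<in>V. r (y i)) / del \<le> C * n" using del by (simp add: pos_divide_le_eq)
      have "0 \<le> r (y i)" if "i \<in> V" for i
        using r(1)[of i] blk(3)[OF P V] that C1 del by (smt (verit) mult_pos_pos subsetD)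
      then have "0 \<le> (\<Sum>i\<in>V. r (y i)) / del" using del by (simp add: sum_nonneg)
      then show "0 \<le> (\<Sum>i\<in>V. r (y i)) / del * laplacian_minor w V \<and>
          (\<Sum>i\<in>V. r (y i)) / del * laplacian_minor w V \<le> C * n * laplacian_minor w V"
        using up minor0[OF blk(1,2)[OF P V]] by (intro conjI mult_nonneg_nonneg mult_right_mono)
    qed
    also have "\<dots> = (C * n) ^ card P * (\<Prod>V\<in>P. laplacian_minor w V)" by (simp add: prod.distrib)
    finally have "fact (card P) * (q ^ n * (\<Prod>V\<in>P. (\<Sum>i\<in>V. r (y i)) / del * laplacian_minor w V)) \<le>
        fact (card P) * (q ^ n * ((C * n) ^ card P * (\<Prod>V\<in>P. laplacian_minor w V)))"
      using q by (intro mult_left_mono) auto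
    then show ?thesis unfolding class_weight_def scaled[OF P] by (simp add: mult_ac)
  qed
  have lower: "q ^ n * (fact (card P0) * C1 ^ card P0 * (\<Prod>V\<in>P0. laplacian_minor w V)) \<le>
      class_weight lam r f y P0"
  proof -
    have "(\<Prod>V\<in>P0. C1 * laplacian_minor w V) \<le> (\<Prod>V\<in>P0. (\<Sum>i\<in>V. r (y i)) / del * laplacian_minor w V)"
    proof (rule prod_mono)
      fix V assume V: "V \<in> P0"
      have "1 * (C1 * del) \<le> real (card V) * (C1 * del)"
        using blk[OF P0 V] C1 del by (intro mult_right_mono) (auto simp: Suc_le_eq card_gt_0_iff)
      also have "\<dots> = (\<Sum>i\<in>V. C1 * del)" by simp
      also have "\<dots> \<le> (\<Sum>i\<in>V. r (y i))"
        by (rule sum_mono) (use r(1) blk(3)[OF P0 V] in auto)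
      finally have "C1 \<le> (\<Sum>i\<in>V. r (y i)) / del" using del by (simp add: pos_le_divide_eq)
      then show "0 \<le> C1 * laplacian_minor w V \<and>
          C1 * laplacian_minor w V \<le> (\<Sum>i\<in>V. r (y i)) / del * laplacian_minor w V"
        using minor0[OF blk(1,2)[OF P0 V]] C1
        by (intro conjI mult_nonneg_nonneg mult_right_mono) auto
    qed
    then have "fact (card P0) * (q ^ n * (C1 ^ card P0 * (\<Prod>V\<in>P0. laplacian_minor w V))) \<le>
        fact (card P0) * (q ^ n * (\<Prod>V\<in>P0. (\<Sum>i\<in>V. r (y i)) / del * laplacian_minor w V))"
      using q by (intro mult_left_mono) (auto simp: prod.distrib)
    then show ?thesis unfolding class_weight_def scaled[OF P0] by (simp add: mult_ac)
  qed
  have w_within: "1 \<le> b * w i j" if "V \<in> P0" "i \<in> V" "j \<in> V" "i \<noteq> j" for V i j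
    using within[OF that] q by (simp add: w_def q_def[symmetric] pos_le_divide_eq)
  have w_between: "w i j \<le> a" if "V \<in> P0" "i \<in> V" "j \<in> {1..n} - V" for V i j
    using between[OF that] q by (simp add: w_def q_def[symmetric] pos_divide_le_eq)
  define M where "M = (\<Prod>V\<in>P0. laplacian_minor w V)"
  have M: "0 < M" unfolding M_def
    by (rule prod_laplacian_minor_pos[OF P0 _ w0 wsym ab(2) w_within]) auto
  have "0 < q ^ n * (fact (card P0) * C1 ^ card P0 * M)" using q C1 M by simp
  then show "0 < class_weight lam r f y P0" using lower by (simp add: M_def)
  define y' where "y' = real n ^ 3 * C * b + real n ^ 2 * a"
  have y': "0 \<le> y'" using ab C by (simp add: y'_def)
  have "?lhs \<le> (\<Sum>P\<in>{P. partition_on {1..n} P} - {P0}.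
      q ^ n * (fact (card P) * (C * n) ^ card P * (\<Prod>V\<in>P. laplacian_minor w V)))"
    by (rule sum_mono) (use upper in auto)
  also have "\<dots> = q ^ n * (\<Sum>P\<in>{P. partition_on {1..n} P} - {P0}.
      fact (card P) * (C * n) ^ card P * (\<Prod>V\<in>P. laplacian_minor w V))"
    by (simp add: sum_distrib_left)
  also have "\<dots> \<le> q ^ n * ((\<Sum>(S, B)\<in>cut_pairs {1..n} (card P0).
      fact (card S) * (C * n) ^ card S * (a * n) ^ card B * b ^ (card S + card B - card P0)) * M)"
    unfolding M_def using q C0
      other_partitions_bound[where c = "\<lambda>k. fact k * (C * n) ^ k",
        OF P0 _ w0 wsym ab(2,1) w_within w_between]
    by (intro mult_left_mono) simp_all
  also have "\<dots> \<le> q ^ n * (exp 2 * (fact (card P0) * (real n ^ 2 * C) ^ card P0 * y') * M)"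
    unfolding y'_def using q M n
    by (intro mult_left_mono mult_right_mono cut_pairs_sum_bound[OF _ _ n C ab x z]) auto
  also have "\<dots> = exp 2 * (real n ^ 2 * C / C1) ^ card P0 * y' *
      (q ^ n * (fact (card P0) * C1 ^ card P0 * M))"
    using C1 by (simp add: power_divide)
  also have "\<dots> \<le> exp 2 * (real n ^ 2 * C / C1) ^ card P0 * y' * class_weight lam r f y P0"
    using lower y' C C1 by (intro mult_left_mono) (auto simp: M_def)
  finally show "?lhs \<le> exp 2 * (real n ^ 2 * C / C1) ^ card P0 * (real n ^ 3 * C * b + real n ^ 2 * a) *
      class_weight lam r f y P0" by (simp add: y'_def)
qed

section \<open>Consistency\<close>

lemma oracle_label_unique:
  assumes V0: "oracle_partition V0" and "k \<ge> 1" "k' \<ge> 1" "i \<in> V0 k" "i \<in> V0 k'"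
  shows "k = k'"
  using assms unfolding oracle_partition_def disjoint_family_on_def by blast

text \<open>A label is recovered from any index in its cluster, so there are at most
  \<open>n\<close> of them.\<close>

lemma finite_oracle_labels:
  assumes "oracle_partition V0"
  shows "finite (oracle_labels V0 n)"
proof (rule finite_surj)
  show "oracle_labels V0 n \<subseteq> (\<lambda>i. THE k. k \<ge> 1 \<and> i \<in> V0 k) ` {1..n}"
  proof
    fix k assume "k \<in> oracle_labels V0 n"
    then have "k \<ge> 1" "V0 k \<inter> {1..n} \<noteq> {}" by (auto simp: oracle_labels_def)
    then obtain i where i: "k \<ge> 1" "i \<in> V0 k" "i \<in> {1..n}" by blast
    moreover have "(THE k. k \<ge> 1 \<and> i \<in> V0 k) = k"
      using i oracle_label_unique[OF assms] by (intro the_equality) auto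
    ultimately show "k \<in> (\<lambda>i. THE k. k \<ge> 1 \<and> i \<in> V0 k) ` {1..n}" by force
  qed
qed simp

lemma set_oracle_blocks:
  "oracle_partition V0 \<Longrightarrow> set (oracle_blocks V0 n) = (\<lambda>k. V0 k \<inter> {1..n}) ` oracle_labels V0 n"
  by (simp add: oracle_blocks_def finite_oracle_labels)

lemma oracle_blocks_facts:
  assumes V0: "oracle_partition V0"
  shows oracle_blocks_in: "oracle_blocks V0 n \<in> ordered_partitions n"
    and card_oracle_blocks: "card (set (oracle_blocks V0 n)) = oracle_K V0 n"
    and partition_oracle_blocks: "partition_on {1..n} (set (oracle_blocks V0 n))"
proof -
  note disj = oracle_label_unique[OF V0]
  have inj: "inj_on (\<lambda>k. V0 k \<inter> {1..n}) (oracle_labels V0 n)"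
  proof (rule inj_onI)
    fix k l assume kl: "k \<in> oracle_labels V0 n" "l \<in> oracle_labels V0 n"
      "V0 k \<inter> {1..n} = V0 l \<inter> {1..n}"
    then have "V0 k \<inter> {1..n} \<noteq> {}" by (simp add: oracle_labels_def)
    then obtain i where "i \<in> V0 k" "i \<in> V0 l" using kl(3) by blast
    then show "k = l" using kl(1,2) by (intro disj) (auto simp: oracle_labels_def)
  qed
  show "card (set (oracle_blocks V0 n)) = oracle_K V0 n"
    using inj by (simp add: set_oracle_blocks[OF V0] card_image oracle_K_def)
  show part: "partition_on {1..n} (set (oracle_blocks V0 n))"
    unfolding set_oracle_blocks[OF V0]
  proof (rule partition_onI)
    have "i \<in> (\<Union>k\<in>oracle_labels V0 n. V0 k \<inter> {1..n})" if "i \<in> {1..n}" for i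
    proof -
      have "i \<in> (\<Union>k\<in>{1..}. V0 k)" using V0 that by (auto simp: oracle_partition_def)
      then obtain k where k: "k \<ge> 1" "i \<in> V0 k" by auto
      then have "k \<in> oracle_labels V0 n" using that unfolding oracle_labels_def by blast
      then show ?thesis using that k by blast
    qed
    then show "\<Union> ((\<lambda>k. V0 k \<inter> {1..n}) ` oracle_labels V0 n) = {1..n}" by blast
  next
    fix p q assume pq: "p \<in> (\<lambda>k. V0 k \<inter> {1..n}) ` oracle_labels V0 n"
      "q \<in> (\<lambda>k. V0 k \<inter> {1..n}) ` oracle_labels V0 n" "p \<noteq> q"
    then obtain k l where kl: "k \<ge> 1" "l \<ge> 1" "p = V0 k \<inter> {1..n}" "q = V0 l \<inter> {1..n}"
      by (auto simp: oracle_labels_def)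
    show "disjnt p q"
    proof (rule ccontr)
      assume "\<not> disjnt p q"
      then obtain i where "i \<in> V0 k" "i \<in> V0 l" using kl by (auto simp: disjnt_def)
      then show False using disj[OF kl(1,2)] kl pq(3) by blast
    qed
  qed (auto simp: oracle_labels_def)
  have "distinct (oracle_blocks V0 n)"
    using inj finite_oracle_labels[OF V0] by (simp add: oracle_blocks_def distinct_map)
  then show "oracle_blocks V0 n \<in> ordered_partitions n"
    using part by (simp add: ordered_partitions_def)
qed

lemma oracle_blocks_pairs:
  assumes V0: "oracle_partition V0" and V: "V \<in> set (oracle_blocks V0 n)" "i \<in> V"
  shows "j \<in> V \<Longrightarrow> i \<noteq> j \<Longrightarrow> (i, j) \<in> within_pairs V0 n"
    and "j \<in> {1..n} - V \<Longrightarrow> (i, j) \<in> between_pairs V0 n"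
proof -
  obtain k where k: "k \<ge> 1" "V = V0 k \<inter> {1..n}"
    using V(1) by (auto simp: set_oracle_blocks[OF V0] oracle_labels_def)
  show "(i, j) \<in> within_pairs V0 n" if "j \<in> V" "i \<noteq> j"
    using that k V by (auto simp: within_pairs_def same_cluster_def)
  show "(i, j) \<in> between_pairs V0 n" if j: "j \<in> {1..n} - V"
  proof -
    have i: "i \<in> V0 k" "i \<in> {1..n}" using V k by auto
    have "\<not> same_cluster V0 i j"
    proof
      assume "same_cluster V0 i j"
      then obtain l where l: "l \<ge> 1" "i \<in> V0 l" "j \<in> V0 l" by (auto simp: same_cluster_def)
      then have "l = k" using oracle_label_unique[OF V0 l(1) k(1) l(2) i(1)] by simp
      then show False using l j k by blast
    qed
    then show ?thesis using i j V(2) by (auto simp: between_pairs_def)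
  qed
qed

text \<open>Keeps the base \<open>K - 1 + i1\<close> of the between-cluster rate at
  \<open>1 + i1\<close> or more whenever that condition concerns some pair.\<close>

lemma oracle_K_ge_2:
  assumes V0: "oracle_partition V0" and st: "(s, t) \<in> between_pairs V0 n"
  shows "2 \<le> oracle_K V0 n"
proof -
  have "s \<in> (\<Union>k\<in>{1..}. V0 k)" "t \<in> (\<Union>k\<in>{1..}. V0 k)"
    using V0 st by (auto simp: oracle_partition_def between_pairs_def)
  then obtain k l where kl: "k \<ge> 1" "s \<in> V0 k" "l \<ge> 1" "t \<in> V0 l" by auto
  then have "k \<noteq> l" using st by (auto simp: between_pairs_def same_cluster_def)
  moreover have "{k, l} \<subseteq> oracle_labels V0 n"
    using kl st by (auto simp: oracle_labels_def between_pairs_def)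
  then have "card {k, l} \<le> oracle_K V0 n"
    unfolding oracle_K_def by (rule card_mono[OF finite_oracle_labels[OF V0]])
  ultimately show ?thesis by simp
qed

section \<open>Pairwise bounds on the separation event\<close>

lemma powi_minus_le:
  fixes x z c :: real
  assumes "0 < z" "z \<le> x" "0 < c"
  shows "c * x powi (- int n) \<le> c / z ^ n"
proof -
  have "inverse (x ^ n) \<le> inverse (z ^ n)"
    using assms by (intro le_imp_inverse_le power_mono) auto
  then show ?thesis using assms by (simp add: power_int_minus divide_inverse)
qed

lemma separation_event_between:
  assumes V0: "oracle_partition V0" and y: "y \<in> separation_event V0 n del lam f c1 c2 i1 i2"
    and pos: "0 < del" "0 < lam" "0 < c1" "0 < i1"
    and st: "(s, t) \<in> between_pairs V0 n"
  shows "edge_weight f y s t \<le> c1 / (1 + i1) ^ n * (del * lam)"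
proof -
  have "ereal (edge_weight f y s t) \<le> (SUP (s, t)\<in>between_pairs V0 n. ereal (edge_weight f y s t))"
    using st by (intro SUP_upper2[OF st]) simp
  then have "ereal (edge_weight f y s t) / ereal (del * lam) \<le>
      (SUP (s, t)\<in>between_pairs V0 n. ereal (edge_weight f y s t)) / ereal (del * lam)"
    using pos by (intro ereal_divide_right_mono) auto
  also have "\<dots> \<le> ereal (c1 * (real (oracle_K V0 n) - 1 + i1) powi (- int n))"
    using y by (simp add: separation_event_def)
  finally have "edge_weight f y s t / (del * lam) \<le> c1 * (real (oracle_K V0 n) - 1 + i1) powi (- int n)"
    using pos by simp
  also have "\<dots> \<le> c1 / (1 + i1) ^ n"
    using oracle_K_ge_2[OF V0 st] pos by (intro powi_minus_le) auto
  finally show ?thesis using pos by (simp add: pos_divide_le_eq)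
qed

text \<open>With at least one cluster the base \<open>K + 1 + i2\<close> is at least 2, which is the
  origin of \<open>2 ^ n\<close>.\<close>

lemma separation_event_within:
  assumes y: "y \<in> separation_event V0 n del lam f c1 c2 i1 i2"
    and f0: "\<And>u v. 0 \<le> f u v"
    and pos: "0 < del" "0 < lam" "0 < c2" "0 < i2"
    and st: "(s, t) \<in> within_pairs V0 n" and K: "1 \<le> oracle_K V0 n"
  shows "del * lam \<le> c2 / 2 ^ n * edge_weight f y s t"
proof -
  define I where "I = (INF (s, t)\<in>within_pairs V0 n. ereal (edge_weight f y s t))"
  define \<beta> where "\<beta> = c2 * (real (oracle_K V0 n) + 1 + i2) powi (- int n)"
  have le: "ereal (del * lam) / I \<le> ereal \<beta>"
    using y by (simp add: separation_event_def I_def \<beta>_def)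
  have "I \<le> ereal (edge_weight f y s t)"
    unfolding I_def using st by (intro INF_lower2[OF st]) simp
  moreover have "0 \<le> I" unfolding I_def using f0 by (auto intro!: INF_greatest simp: edge_weight_def)
  ultimately obtain m where m: "I = ereal m" "0 \<le> m" "m \<le> edge_weight f y s t"
    by (cases I) auto
  \<comment> \<open>A zero infimum makes the extended-real ratio infinite, which the event
    excludes.\<close>
  have "m \<noteq> 0"
  proof
    assume "m = 0"
    then have "ereal (del * lam) / I = \<infinity>" using m pos by (simp add: divide_ereal_def)
    then show False using le by simp
  qed
  then have "0 < m" using m by simp
  then have "del * lam \<le> \<beta> * m" using le m by (simp add: pos_divide_le_eq)
  also have "\<dots> \<le> c2 / 2 ^ n * edge_weight f y s t"
    unfolding \<beta>_def using pos K m by (intro mult_mono powi_minus_le) auto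
  finally show ?thesis .
qed

lemma separation_event_measurable:
  assumes space: "space M = {1..n} \<rightarrow>\<^sub>E UNIV"
    and meas: "\<And>s t. s \<in> {1..n} \<Longrightarrow> t \<in> {1..n} \<Longrightarrow> s \<noteq> t \<Longrightarrow>
      (\<lambda>y. edge_weight f y s t) \<in> borel_measurable M"
  shows "separation_event V0 n del lam f c1 c2 i1 i2 \<in> sets M"
proof -
  have cnt: "countable (between_pairs V0 n)" "countable (within_pairs V0 n)"
    by (auto intro!: countable_finite finite_subset[of _ "{1..n} \<times> {1..n}"]
        simp: between_pairs_def within_pairs_def)
  have 1: "(\<lambda>y. SUP (s, t)\<in>between_pairs V0 n. ereal (edge_weight f y s t)) \<in> borel_measurable M"
    using meas by (intro borel_measurable_SUP cnt)
      (auto simp: between_pairs_def intro!: borel_measurable_ereal)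
  have 2: "(\<lambda>y. INF (s, t)\<in>within_pairs V0 n. ereal (edge_weight f y s t)) \<in> borel_measurable M"
    using meas by (intro borel_measurable_INF cnt)
      (auto simp: within_pairs_def intro!: borel_measurable_ereal)
  note [measurable] = 1 2
  show ?thesis unfolding separation_event_def space[symmetric] by measurable
qed

section \<open>Posterior mass outside the oracle class\<close>

lemma class_weight_nonneg:
  assumes "partition_on {1..n} P" "0 < lam" "\<And>u. 0 < r u" "\<And>u v. 0 \<le> f u v" "\<And>u v. f u v = f v u"
  shows "0 \<le> class_weight lam r f y P"
proof -
  have "0 \<le> laplacian_minor (edge_weight f y) V" if "V \<in> P" for V
  proof (rule laplacian_minor_nonneg)
    show "V \<noteq> {}" using assms(1) that by (auto simp: partition_on_def)
    have "V \<subseteq> {1..n}" using assms(1) that by (auto simp: partition_on_def)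
    then show "finite V" using finite_subset by blast
    show "edge_weight f y i j = edge_weight f y j i" for i j
      using assms(5) by (simp add: edge_weight_def)
  qed (simp add: assms edge_weight_def)
  then show ?thesis unfolding class_weight_def using assms
    by (intro mult_nonneg_nonneg prod_nonneg sum_nonneg ballI) (auto intro: less_imp_le)
qed

text \<open>If the class has weight \<open>u > 0\<close> and all others together \<open>v\<close>,
  the remaining mass is \<open>v / (u + v)\<close>, which is at most the odds
  \<open>v / u\<close>.\<close>

lemma post_not_equiv_bounds:
  fixes n lam r f y
  assumes Vs: "Vs \<in> ordered_partitions n"
    and pos: "0 < lam" "\<And>u. 0 < r u" "\<And>u v. 0 \<le> f u v" "\<And>u v. f u v = f v u"
  shows "0 \<le> post_not_equiv n lam r f y Vs" "post_not_equiv n lam r f y Vs \<le> 1"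
    and "0 < class_weight lam r f y (set Vs) \<Longrightarrow>
      (\<Sum>P\<in>{P. partition_on {1..n} P} - {set Vs}. class_weight lam r f y P) \<le>
        e * class_weight lam r f y (set Vs) \<Longrightarrow> post_not_equiv n lam r f y Vs \<le> e"
proof -
  define u where "u = class_weight lam r f y (set Vs)"
  define v where "v = (\<Sum>P\<in>{P. partition_on {1..n} P} - {set Vs}. class_weight lam r f y P)"
  have P: "partition_on {1..n} (set Vs)" using Vs by (simp add: ordered_partitions_def)
  have cw: "0 \<le> class_weight lam r f y P" if "partition_on {1..n} P" for P
    by (rule class_weight_nonneg[OF that pos])
  have u: "0 \<le> u" unfolding u_def by (rule cw[OF P])
  have v: "0 \<le> v" unfolding v_def using cw by (intro sum_nonneg) auto
  have "(\<Sum>P\<in>{P. partition_on {1..n} P}. class_weight lam r f y P) = u + v"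
    unfolding u_def v_def using P finitely_many_partition_on[of "{1..n}"]
    by (intro sum.remove) auto
  then have eq: "post_not_equiv n lam r f y Vs = 1 - u / (u + v)"
    by (simp add: post_not_equiv_def post_equiv_eq_class_weight[OF Vs] u_def)
  \<comment> \<open>The argument covers \<open>u + v = 0\<close> too, where the quotient is 0 by
    convention.\<close>
  show "0 \<le> post_not_equiv n lam r f y Vs" "post_not_equiv n lam r f y Vs \<le> 1"
    unfolding eq using u v by (auto simp: divide_le_eq_1)
  show "post_not_equiv n lam r f y Vs \<le> e" if "0 < class_weight lam r f y (set Vs)"
    "(\<Sum>P\<in>{P. partition_on {1..n} P} - {set Vs}. class_weight lam r f y P) \<le>
        e * class_weight lam r f y (set Vs)"
  proof -
    have u: "0 < u" and ve: "v \<le> e * u" using that by (simp_all add: u_def v_def)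
    have "1 - u / (u + v) = v / (u + v)" using u v by (simp add: field_simps)
    also have "\<dots> \<le> v / u" using u v by (intro divide_left_mono) auto
    also have "\<dots> \<le> e" using u ve by (simp add: pos_divide_le_eq)
    finally show ?thesis unfolding eq .
  qed
qed

text \<open>On the logarithmic scale the linear term \<open>- n * ln g\<close> beats the terms of
  order \<open>sqrt n * ln n\<close>.\<close>

lemma exp_sqrt_ln_geometric_tendsto_0:
  fixes g d :: real
  assumes "1 < g"
  shows "(\<lambda>n. exp (sqrt (real n) * (2 * ln (real n) + d)) * (real n ^ 3 / g ^ n)) \<longlonglongrightarrow> 0"
proof -
  define L where "L = ln g"
  have L: "0 < L" using assms by (simp add: L_def)
  have "(\<lambda>n. exp (sqrt (real n) * (2 * ln (real n) + d) + 3 * ln (real n) - L * real n)) \<longlonglongrightarrow> 0"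
    using L by real_asymp
  moreover have "\<forall>\<^sub>F n in sequentially.
      exp (sqrt (real n) * (2 * ln (real n) + d) + 3 * ln (real n) - L * real n) =
      exp (sqrt (real n) * (2 * ln (real n) + d)) * (real n ^ 3 / g ^ n)"
    using eventually_gt_at_top[of 0]
  proof eventually_elim
    case (elim n)
    have "exp (3 * ln (real n)) = real n ^ 3"
      using elim by (simp add: exp_of_nat_mult[of 3, simplified])
    moreover have "exp (L * real n) = g ^ n"
      using assms by (simp add: L_def exp_of_nat2_mult)
    ultimately show ?case by (simp add: exp_add exp_diff)
  qed
  ultimately show ?thesis by (rule Lim_transform_eventually)
qed

text \<open>The power \<open>(n^2 * D) ^ K\<close> is \<open>exp (K * (2 * ln n + ln D))\<close>,
  and the growth condition enters as \<open>K \<le> sqrt n\<close> for large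
  \<open>n\<close>.\<close>

lemma ratio_tendsto_0:
  fixes K :: "nat \<Rightarrow> nat" and D A B g h :: real
  assumes K: "(\<lambda>n. real (K n)) \<in> o(\<lambda>n. sqrt (real n))"
    and D: "0 < D" and A: "0 \<le> A" and B: "0 \<le> B" and g: "1 < g" and h: "1 < h"
  shows "(\<lambda>n. exp 2 * (real n ^ 2 * D) ^ K n * (real n ^ 3 * (A / g ^ n) + real n ^ 2 * (B / h ^ n)))
    \<longlonglongrightarrow> 0"
proof -
  \<comment> \<open>The maximum with 1 keeps the exponent nonnegative, so that \<open>K n\<close>
    may be replaced by the larger \<open>sqrt n\<close>.\<close>
  define d where "d = ln (max 1 D)"
  define E where "E n = exp (sqrt (real n) * (2 * ln (real n) + d))" for n
  have "\<forall>\<^sub>F n in sequentially. norm (real (K n)) \<le> 1 * norm (sqrt (real n))"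
    using landau_o.smallD[OF K, of 1] by simp
  then have bound: "\<forall>\<^sub>F n in sequentially.
      norm (exp 2 * (real n ^ 2 * D) ^ K n * (real n ^ 3 * (A / g ^ n) + real n ^ 2 * (B / h ^ n))) \<le>
      exp 2 * A * (E n * (real n ^ 3 / g ^ n)) + exp 2 * B * (E n * (real n ^ 3 / h ^ n))"
    using eventually_ge_at_top[of 1]
  proof eventually_elim
    case (elim n)
    have n: "1 \<le> real n" using elim by simp
    have lnn: "0 \<le> 2 * ln (real n) + d" using n by (simp add: d_def)
    have "(real n ^ 2 * D) ^ K n \<le> (real n ^ 2 * max 1 D) ^ K n"
      using D n by (intro power_mono mult_left_mono) auto
    also have "real n ^ 2 * max 1 D = exp (2 * ln (real n) + d)"
      using n by (simp add: exp_add d_def exp_of_nat_mult[of 2, simplified])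
    also have "\<dots> ^ K n = exp (real (K n) * (2 * ln (real n) + d))"
      by (simp add: exp_of_nat_mult)
    also have "\<dots> \<le> E n"
      unfolding E_def using elim lnn by (simp add: mult_right_mono)
    finally have KE: "(real n ^ 2 * D) ^ K n \<le> E n" .
    have "real n ^ 2 \<le> real n ^ 3" using n by (intro power_increasing) auto
    then have "real n ^ 3 * (A / g ^ n) + real n ^ 2 * (B / h ^ n) \<le>
        real n ^ 3 * (A / g ^ n) + real n ^ 3 * (B / h ^ n)"
      using B h by (intro add_left_mono mult_right_mono) auto
    then have "(real n ^ 2 * D) ^ K n * (real n ^ 3 * (A / g ^ n) + real n ^ 2 * (B / h ^ n)) \<le>
        E n * (real n ^ 3 * (A / g ^ n) + real n ^ 3 * (B / h ^ n))"
      using KE A B g h by (intro mult_mono) (auto simp: E_def)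
    then have "exp 2 * ((real n ^ 2 * D) ^ K n * (real n ^ 3 * (A / g ^ n) + real n ^ 2 * (B / h ^ n))) \<le>
        exp 2 * (E n * (real n ^ 3 * (A / g ^ n) + real n ^ 3 * (B / h ^ n)))"
      by (rule mult_left_mono) simp
    also have "\<dots> = exp 2 * A * (E n * (real n ^ 3 / g ^ n)) + exp 2 * B * (E n * (real n ^ 3 / h ^ n))"
      by (simp add: algebra_simps)
    finally have le: "exp 2 * (real n ^ 2 * D) ^ K n * (real n ^ 3 * (A / g ^ n) + real n ^ 2 * (B / h ^ n)) \<le>
        exp 2 * A * (E n * (real n ^ 3 / g ^ n)) + exp 2 * B * (E n * (real n ^ 3 / h ^ n))"
      by (simp only: mult.assoc)
    have "0 \<le> exp 2 * (real n ^ 2 * D) ^ K n * (real n ^ 3 * (A / g ^ n) + real n ^ 2 * (B / h ^ n))"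
      using D A B g h by (intro mult_nonneg_nonneg add_nonneg_nonneg) auto
    then show ?case unfolding real_norm_def using le by (simp only: abs_of_nonneg)
  qed
  have lim: "(\<lambda>n. exp 2 * A * (E n * (real n ^ 3 / g ^ n)) + exp 2 * B * (E n * (real n ^ 3 / h ^ n)))
      \<longlonglongrightarrow> exp 2 * A * 0 + exp 2 * B * 0"
    unfolding E_def by (intro tendsto_intros exp_sqrt_ln_geometric_tendsto_0 g h)
  show ?thesis
    by (rule Lim_null_comparison[OF bound]) (use lim in simp)
qed

text \<open>On \<open>E\<close> the posterior error is at most the odds bound \<open>e\<close>, up
  to a null set; off \<open>E\<close> it is at most 1, which costs the probability of the
  complement.\<close>

lemma expected_post_not_equiv_le:
  fixes M :: "(nat \<Rightarrow> 'a) measure" and f :: "'a \<Rightarrow> 'a \<Rightarrow> real"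
    and r :: "'a \<Rightarrow> real" and del lam C1 C c1 c2 i1 i2 :: real
    and V0 :: "nat \<Rightarrow> nat set" and n :: nat
  defines "E \<equiv> separation_event V0 n del lam f c1 c2 i1 i2"
    and "e \<equiv> exp 2 * (real n ^ 2 * C / C1) ^ oracle_K V0 n *
      (real n ^ 3 * C * (c2 / 2 ^ n) + real n ^ 2 * (c1 / (1 + i1) ^ n))"
  assumes V0: "oracle_partition V0" and M: "prob_space M" and space: "space M = {1..n} \<rightarrow>\<^sub>E UNIV"
    and meas: "\<forall>s\<in>{1..n}. \<forall>t\<in>{1..n}. s \<noteq> t \<longrightarrow>
      (\<lambda>y. edge_weight f y s t) \<in> borel_measurable M"
    and f0: "\<And>u v. 0 \<le> f u v" and fsym: "\<And>u v. f u v = f v u" and r0: "\<And>u. 0 < r u"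
    and del: "0 < del" and lam: "0 < lam" and n: "1 \<le> n" and C1: "0 < C1" and C: "1 \<le> C"
    and r: "AE y in M. \<forall>i\<in>{1..n}. C1 * del \<le> r (y i) \<and> r (y i) \<le> C * del"
    and pos: "0 < c1" "0 < c2" "0 < i1" "0 < i2"
    and x: "real n ^ 3 * C * (c2 / 2 ^ n) \<le> 1" and z: "real n ^ 2 * (c1 / (1 + i1) ^ n) \<le> 1"
  shows "0 \<le> (LINT y|M. post_not_equiv n lam r f y (oracle_blocks V0 n))"
    and "(LINT y|M. post_not_equiv n lam r f y (oracle_blocks V0 n)) \<le> e + measure M (space M - E)"
proof -
  interpret prob_space M by (rule M)
  define post where "post y = post_not_equiv n lam r f y (oracle_blocks V0 n)" for y
  define P where "P = set (oracle_blocks V0 n)"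
  have P: "partition_on {1..n} P" "card P = oracle_K V0 n"
    using partition_oracle_blocks[OF V0] card_oracle_blocks[OF V0] by (simp_all add: P_def)
  note post_bounds = post_not_equiv_bounds[where r = r and f = f, OF oracle_blocks_in[OF V0, of n] lam r0 f0 fsym,
      folded P_def post_def]
  have En: "E \<in> sets M"
    unfolding E_def by (rule separation_event_measurable[OF space]) (use meas in blast)
  have e0: "0 \<le> e" using C C1 pos by (simp add: e_def)
  have "P \<noteq> {}" using P(1) n by (auto simp: partition_on_def)
  moreover have "finite P" by (simp add: P_def)
  ultimately have K1: "1 \<le> oracle_K V0 n" using P(2) by (auto simp: Suc_le_eq card_gt_0_iff)
  have post_le: "post y \<le> e" if y: "y \<in> E" and r: "\<forall>i\<in>{1..n}. C1 * del \<le> r (y i) \<and> r (y i) \<le> C * del" for y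
  proof -
    have yE: "y \<in> separation_event V0 n del lam f c1 c2 i1 i2" using y by (simp add: E_def)
    have within: "del * lam \<le> c2 / 2 ^ n * edge_weight f y i j"
      if "V \<in> P" "i \<in> V" "j \<in> V" "i \<noteq> j" for V i j
      using oracle_blocks_pairs(1)[OF V0, of V n i j] that unfolding P_def
      by (intro separation_event_within[OF yE f0 del lam pos(2,4) _ K1]) auto
    have between: "edge_weight f y i j \<le> c1 / (1 + i1) ^ n * (del * lam)"
      if "V \<in> P" "i \<in> V" "j \<in> {1..n} - V" for V i j
      using oracle_blocks_pairs(2)[OF V0, of V n i j] that unfolding P_def
      by (intro separation_event_between[OF V0 yE del lam pos(1,3)]) auto
    have r1: "C1 * del \<le> r (y i)" and r2: "r (y i) \<le> C * del" if "i \<in> {1..n}" for i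
      using r that by auto
    have a: "0 \<le> c1 / (1 + i1) ^ n" and b: "0 \<le> c2 / 2 ^ n" using pos by auto
    note ratio = class_weight_ratio[where f = f and r = r and y = y, OF n P(1) f0 fsym lam del C1 C r1 r2 a b within between x z]
    show ?thesis
      by (rule post_bounds(3)) (use ratio in \<open>simp_all add: e_def P(2)\<close>)
  qed
  have AE_le: "AE y in M. post y \<le> e + indicator (space M - E) y"
    using r AE_space
  proof eventually_elim
    case (elim y)
    then show ?case
      using post_le[of y] post_bounds(2)[of y] e0 by (cases "y \<in> E") auto
  qed
  show "0 \<le> (LINT y|M. post_not_equiv n lam r f y (oracle_blocks V0 n))"
    unfolding post_def[symmetric] using post_bounds(1) by simp
  have "(LINT y|M. post y) \<le> e + measure M (space M - E)"
  proof (cases "integrable M post")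
    case True
    have ind: "integrable M (indicat_real (space M - E))"
      using En by (intro integrable_real_indicator) (auto simp: less_top[symmetric])
    have "(LINT y|M. post y) \<le> (LINT y|M. e + indicator (space M - E) y)"
      by (rule integral_mono_AE[OF True Bochner_Integration.integrable_add[OF integrable_const ind] AE_le])
    also have "\<dots> = e + measure M (space M - E)"
      by (subst Bochner_Integration.integral_add[OF integrable_const ind]) (simp add: prob_space Int_absorb2)
    finally show ?thesis .
  next
    \<comment> \<open>The integral of a function that is not integrable is 0 by convention, so
      \<open>e \<ge> 0\<close> suffices.\<close>
    case False
    then show ?thesis using e0 by (simp add: not_integrable_integral_eq)
  qed
  then show "(LINT y|M. post_not_equiv n lam r f y (oracle_blocks V0 n)) \<le> e + measure M (space M - E)"
    by (simp add: post_def)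
qed

theorem theorem3p4:
  fixes V0 :: "nat \<Rightarrow> nat set"
    and P0 :: "nat \<Rightarrow> (nat \<Rightarrow> 'a :: metric_space) measure"
    and f :: "nat \<Rightarrow> 'a \<Rightarrow> 'a \<Rightarrow> real"
    and r :: "nat \<Rightarrow> 'a \<Rightarrow> real"
    and del lam :: "nat \<Rightarrow> real"
  assumes V0_partition: "oracle_partition V0"
    and P0_prob: "\<And>n. prob_space (P0 n)"
    and P0_space: "\<And>n. space (P0 n) = {1..n} \<rightarrow>\<^sub>E UNIV"
    and f_meas: "\<And>n s t. s \<in> {1..n} \<Longrightarrow> t \<in> {1..n} \<Longrightarrow> s \<noteq> t \<Longrightarrow>
                   (\<lambda>y. edge_weight (f n) y s t) \<in> borel_measurable (P0 n)"
    and r_meas: "\<And>n i. i \<in> {1..n} \<Longrightarrow> (\<lambda>y. r n (y i)) \<in> borel_measurable (P0 n)"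
    and f_nonneg: "\<And>n u v. f n u v \<ge> 0"
    and f_sym: "\<And>n u v. f n u v = f n v u"
    and r_pos: "\<And>n u. r n u > 0"
    and del_pos: "\<And>n. del n > 0"
    and lam_pos: "\<And>n. lam n > 0"
    and A1: "\<exists>C1>0. \<exists>C2>0. \<forall>\<^sub>F n in sequentially. AE y in P0 n.
               C1 * del n \<le> Min ((\<lambda>i. r n (y i)) ` {1..n}) \<and>
               Max ((\<lambda>i. r n (y i)) ` {1..n}) \<le> C2 * del n"
    and A2: "(\<lambda>n. real (oracle_K V0 n)) \<in> o(\<lambda>n. sqrt (real n))"
    and sep: "\<exists>c1>0. \<exists>c2>0. \<exists>i1>0. \<exists>i2>0.
               (\<lambda>n. measure (P0 n) (space (P0 n) -
                  separation_event V0 n (del n) (lam n) (f n) c1 c2 i1 i2))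
               \<longlonglongrightarrow> 0"
  shows "(\<lambda>n. LINT y|P0 n. post_not_equiv n (lam n) (r n) (f n) y (oracle_blocks V0 n))
           \<longlonglongrightarrow> 0"
proof -
  obtain C1 C2 where C1: "C1 > 0"
    and r_bounds: "\<forall>\<^sub>F n in sequentially. AE y in P0 n.
      C1 * del n \<le> Min ((\<lambda>i. r n (y i)) ` {1..n}) \<and> Max ((\<lambda>i. r n (y i)) ` {1..n}) \<le> C2 * del n"
    using A1 by blast
  obtain c1 c2 i1 i2 where pos: "c1 > 0" "c2 > 0" "i1 > 0" "i2 > 0"
    and bad_tendsto: "(\<lambda>n. measure (P0 n) (space (P0 n) -
      separation_event V0 n (del n) (lam n) (f n) c1 c2 i1 i2)) \<longlonglongrightarrow> 0"
    using sep by blast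
  \<comment> \<open>The maximum gives \<open>n^2 * C \<ge> 1\<close>, so that raising the exponent
    of the root factors only increases them.\<close>
  define C where "C = max 1 C2"
  have C: "1 \<le> C" "C2 \<le> C" by (simp_all add: C_def)
  define x where "x n = real n ^ 3 * C * (c2 / 2 ^ n)" for n :: nat
  define z where "z n = real n ^ 2 * (c1 / (1 + i1) ^ n)" for n :: nat
  define eps where "eps n = exp 2 * (real n ^ 2 * C / C1) ^ oracle_K V0 n * (x n + z n)" for n
  define bad where "bad n = measure (P0 n) (space (P0 n) -
      separation_event V0 n (del n) (lam n) (f n) c1 c2 i1 i2)" for n
  define risk where "risk n = (LINT y|P0 n. post_not_equiv n (lam n) (r n) (f n) y (oracle_blocks V0 n))" for n
  \<comment> \<open>Instance \<open>D = C / C1\<close>, \<open>A = C * c2\<close>,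
    \<open>g = 2\<close>, \<open>B = c1\<close>, \<open>h = 1 + i1\<close> of
    \<open>ratio_tendsto_0\<close>.\<close>
  have "(\<lambda>n. exp 2 * (real n ^ 2 * (C / C1)) ^ oracle_K V0 n *
      (real n ^ 3 * (C * c2 / 2 ^ n) + real n ^ 2 * (c1 / (1 + i1) ^ n))) \<longlonglongrightarrow> 0"
    using A2 C1 C pos by (intro ratio_tendsto_0) auto
  then have eps_tendsto: "eps \<longlonglongrightarrow> 0"
    by (simp add: eps_def[abs_def] x_def z_def mult.assoc)
  \<comment> \<open>The bound for fixed \<open>n\<close> requires \<open>x n\<close> and
    \<open>z n\<close> to be at most 1, so that higher powers are dominated by first powers.\<close>
  have "x \<longlonglongrightarrow> 0" "z \<longlonglongrightarrow> 0"
    unfolding x_def[abs_def] z_def[abs_def] using pos(3) by real_asymp+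
  then have small: "\<forall>\<^sub>F n in sequentially. x n < 1" "\<forall>\<^sub>F n in sequentially. z n < 1"
    by (auto intro: order_tendstoD)
  have "\<forall>\<^sub>F n in sequentially. 0 \<le> risk n \<and> risk n \<le> eps n + bad n"
    using r_bounds small eventually_ge_at_top[of 1]
  proof eventually_elim
    case (elim n)
    have r_n: "AE y in P0 n. \<forall>i\<in>{1..n}. C1 * del n \<le> r n (y i) \<and> r n (y i) \<le> C * del n"
      using elim(1)
    proof eventually_elim
      case (elim y)
      have "C2 * del n \<le> C * del n" using C del_pos[of n] by (simp add: mult_right_mono)
      then show ?case
        using elim Min_le[of "(\<lambda>i. r n (y i)) ` {1..n}"] Max_ge[of "(\<lambda>i. r n (y i)) ` {1..n}"]
        by (intro ballI conjI) (meson finite_atLeastAtMost finite_imageI imageI order_trans)+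
    qed
    have f_n: "\<forall>s\<in>{1..n}. \<forall>t\<in>{1..n}. s \<noteq> t \<longrightarrow>
        (\<lambda>y. edge_weight (f n) y s t) \<in> borel_measurable (P0 n)"
      using f_meas by blast
    note le = expected_post_not_equiv_le[OF V0_partition P0_prob[of n] P0_space f_n f_nonneg f_sym
        r_pos del_pos[of n] lam_pos[of n] \<open>1 \<le> n\<close> C1 C(1) r_n pos]
    have xz: "real n ^ 3 * C * (c2 / 2 ^ n) \<le> 1" "real n ^ 2 * (c1 / (1 + i1) ^ n) \<le> 1"
      using elim(2,3) by (simp_all add: x_def z_def)
    show ?case
      unfolding risk_def bad_def eps_def x_def z_def by (intro conjI le[OF xz])
  qed
  moreover have "(\<lambda>n. eps n + bad n) \<longlonglongrightarrow> 0"
    using tendsto_add[OF eps_tendsto bad_tendsto] by (simp add: bad_def)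
  ultimately have "risk \<longlonglongrightarrow> 0"
    by (auto simp: eventually_conj_iff intro: tendsto_sandwich[OF _ _ tendsto_const])
  then show ?thesis by (simp add: risk_def[abs_def])
qed

end
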